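(* Let $g:\mathbb R\to\mathbb R$ be a derivator, let $a<b$ be real numbers, and let $B_0$, $B$ and $B_1$ be Banach spaces such that $B_0$ and $B_1$ are reflexive, $B_0$ is compactly embedded in $B$, and $B$ is continuously embedded in $B_1$. If $1<p_0,p_1<\infty$, then the state projection $$\pi_0:\mathbb W_g^{p_0,p_1}([a,b];B_0,B_1)\longrightarrow L_g^{p_0}([a,b);B),\qquad \pi_0(u,z)=u,$$ is compact. Equivalently, from every bounded sequence of pairs in $\mathbb W_g^{p_0,p_1}([a,b];B_0,B_1)$ one can extract a subsequence whose state components (first components) converge strongly in $L_g^{p_0}([a,b);B)$.
   Context: A derivator is a nondecreasing, left-continuous function $g:\mathbb R\to\mathbb R$. Its Lebesgue--Stieltjes measure $\mu_g$ is fixed by $\mu_g([c,d))=g(d)-g(c)$ for $c<d$. $L_g^p([a,b);X)$ denotes the Bochner space $L^p([a,b),\mu_g;X)$ of equivalence classes modulo $\mu_g$-a.e. equality. The embeddings $i_{0B}:B_0\to B$ (compact) and $i_{B1}:B\to B_1$ (continuous) are fixed injective bounded linear maps, and $i_{01}=i_{B1}\circ i_{0B}:B_0\to B_1$. The Stieltjes evolution graph $\mathbb W_g^{p_0,p_1}([a,b];B_0,B_1)$ is the set of pairs $(u,z)$ with $u\in L_g^{p_0}([a,b);B_0)$ and $z\in L_g^{p_1}([a,b);B_1)$ for which there exists $x\in B_1$ such that $$i_{01}u(t)=x+\int_{[a,t)}z(r)\,d\mu_g(r)\quad\text{for }\mu_g\text{-almost every }t\in[a,b)$$ (Bochner integral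 in $B_1$), with norm $\|(u,z)\|=\|u\|_{L_g^{p_0}([a,b);B_0)}+\|z\|_{L_g^{p_1}([a,b);B_1)}$. In the target space, $u$ is regarded as $B$-valued via $i_{0B}$. *)

theory Defs
  imports "HOL-Analysis.Analysis"
begin

section \<open>Derivators and Lebesgue--Stieltjes measures\<close>

definition derivator :: "(real \<Rightarrow> real) \<Rightarrow> bool" where
  "derivator g \<longleftrightarrow> mono g \<and> (\<forall>t. continuous (at_left t) g)"

text \<open>The library's \<^const>\<open>interval_measure\<close> is for right-continuous functions and half-open
  intervals closed on the right. Reflecting the line gives the version for left-continuous
  functions and intervals closed on the left; see \<open>emeasure_LS_measure\<close> and
  \<open>LS_measure_unique\<close>. The measure lives on the Borel sets and is not completed; as every notion
  below is insensitive to changes on null sets, this makes no difference.\<close>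

definition LS_measure :: "(real \<Rightarrow> real) \<Rightarrow> real measure" where
  "LS_measure g = distr (interval_measure (\<lambda>s. - g (- s))) borel uminus"

lemma sets_LS_measure [simp, measurable_cong]: "sets (LS_measure g) = sets borel"
  by (simp add: LS_measure_def)

lemma space_LS_measure [simp]: "space (LS_measure g) = UNIV"
  by (simp add: LS_measure_def)

lemma emeasure_LS_measure:
  assumes g: "derivator g" and cd: "c \<le> d"
  shows "emeasure (LS_measure g) {c..<d} = ennreal (g d - g c)"
proof -
  let ?F = "\<lambda>s. - g (- s)"
  have mono: "?F x \<le> ?F y" if "x \<le> y" for x y
    using g that by (auto simp: derivator_def mono_def)
  have cont: "continuous (at_right s) ?F" for s
  proof -
    have "(g \<longlongrightarrow> g (- s)) (at_left (- s))"
      using g by (auto simp: derivator_def continuous_within)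
    then have "((\<lambda>x. g (- x)) \<longlongrightarrow> g (- s)) (at_right s)"
      using filterlim_at_left_to_right[of g "nhds (g (- s))" "- s"] by simp
    then show ?thesis
      by (auto simp: continuous_within intro: tendsto_minus)
  qed
  have vi: "uminus -` {c..<d} = {- d <.. - c}"
    by auto
  have m: "(uminus :: real \<Rightarrow> real) \<in> interval_measure ?F \<rightarrow>\<^sub>M borel"
    by simp
  have "emeasure (LS_measure g) {c..<d} = emeasure (interval_measure ?F) {- d <.. - c}"
    unfolding LS_measure_def by (subst emeasure_distr[OF m]) (simp_all add: vi)
  also have "\<dots> = ennreal (?F (- c) - ?F (- d))"
    by (rule emeasure_interval_measure_Ioc) (use cd mono cont in auto)
  finally show ?thesis
    by simp
qed

lemma LS_measure_unique:
  assumes g: "derivator g" and N: "sets N = sets borel"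
    and eq: "\<And>c d. c < d \<Longrightarrow> emeasure N {c..<d} = ennreal (g d - g c)"
  shows "N = LS_measure g"
proof (rule measure_eqI_generator_eq[where E = "range (\<lambda>(c, d). {c..<d::real})"
      and \<Omega> = UNIV and A = "\<lambda>n. {- real n..<real n}"])
  show "Int_stable (range (\<lambda>(c, d). {c..<d::real}))"
    by (auto simp: Int_stable_def)
  have "sigma_sets UNIV (range (\<lambda>(c, d). {c..<d::real})) = sets borel"
    by (subst borel_eq_atLeastLessThan) simp
  then show "sets N = sigma_sets UNIV (range (\<lambda>(c, d). {c..<d::real}))"
    "sets (LS_measure g) = sigma_sets UNIV (range (\<lambda>(c, d). {c..<d::real}))"
    using N by auto
  show "(\<Union>n. {- real n..<real n}) = UNIV"
  proof safe
    fix x :: real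
    obtain n where "\<bar>x\<bar> < real n"
      using reals_Archimedean2 by blast
    then show "x \<in> (\<Union>n. {- real n..<real n})"
      by (intro UN_I[of n]) auto
  qed auto
  show "emeasure N X = emeasure (LS_measure g) X" if X: "X \<in> range (\<lambda>(c, d). {c..<d::real})" for X
  proof -
    obtain c d where "X = {c..<d}"
      using X by auto
    then show ?thesis
      using eq[of c d] emeasure_LS_measure[OF g, of c d] by (cases "c < d") auto
  qed
  show "emeasure N {- real n..<real n} \<noteq> \<infinity>" for n
    using eq[of "- real n" "real n"] by (cases "n = 0") auto
qed auto

section \<open>Bochner integration in arbitrary Banach spaces\<close>

text \<open>The library's Bochner integral needs a second countable codomain. The following is the usual
  theory without separability. Since a strongly measurable function only agrees almost everywhere
  with a Borel measurable one, norms are integrated with \<open>nn_integral\<close>, which respects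
  almost everywhere equality without any measurability assumption.\<close>

definition strongly_measurable :: "'a measure \<Rightarrow> ('a \<Rightarrow> 'b::topological_space) \<Rightarrow> bool" where
  "strongly_measurable M f \<longleftrightarrow>
     (\<exists>s. (\<forall>n. simple_function M (s n)) \<and> (AE x in M. (\<lambda>n::nat. s n x) \<longlonglongrightarrow> f x))"

definition has_strong_integral ::
    "'a measure \<Rightarrow> ('a \<Rightarrow> 'b::real_normed_vector) \<Rightarrow> 'b \<Rightarrow> bool" where
  "has_strong_integral M f I \<longleftrightarrow> strongly_measurable M f \<and>
     (\<exists>s. (\<forall>n::nat. Bochner_Integration.simple_bochner_integrable M (s n)) \<and>
          (\<lambda>n. \<integral>\<^sup>+ x. ennreal (norm (f x - s n x)) \<partial>M) \<longlonglongrightarrow> 0 \<and>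
          (\<lambda>n. Bochner_Integration.simple_bochner_integral M (s n)) \<longlonglongrightarrow> I)"

definition strong_integral :: "'a measure \<Rightarrow> ('a \<Rightarrow> 'b::real_normed_vector) \<Rightarrow> 'b" where
  "strong_integral M f = (THE I. has_strong_integral M f I)"

lemma strongly_measurable_cong_AE:
  assumes "strongly_measurable M f" "AE x in M. f x = h x"
  shows "strongly_measurable M h"
proof -
  obtain s where s: "\<forall>n. simple_function M (s n)" "AE x in M. (\<lambda>n::nat. s n x) \<longlonglongrightarrow> f x"
    using assms(1) by (auto simp: strongly_measurable_def)
  have "AE x in M. (\<lambda>n. s n x) \<longlonglongrightarrow> h x"
    using s(2) assms(2) by eventually_elim simp
  with s(1) show ?thesis
    by (auto simp: strongly_measurable_def)
qed

lemma strongly_measurable_norm: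
  fixes f :: "'a \<Rightarrow> 'b::real_normed_vector"
  assumes "strongly_measurable M f"
  obtains h :: "'a \<Rightarrow> real" where "h \<in> borel_measurable M" "AE x in M. norm (f x) = h x"
proof -
  obtain s where s: "\<forall>n. simple_function M (s n)" "AE x in M. (\<lambda>n::nat. s n x) \<longlonglongrightarrow> f x"
    using assms by (auto simp: strongly_measurable_def)
  have "(\<lambda>x. norm (s n x)) \<in> borel_measurable M" for n
    using s(1) simple_function_compose1[of M "s n" norm]
    by (intro borel_measurable_simple_function) auto
  then have "(\<lambda>x. lim (\<lambda>n. norm (s n x))) \<in> borel_measurable M"
    by (rule borel_measurable_lim_metric)
  moreover have "AE x in M. norm (f x) = lim (\<lambda>n. norm (s n x))"
    using s(2) by eventually_elim (metis limI tendsto_norm)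
  ultimately show thesis
    using that by blast
qed

lemma strongly_measurable_diff:
  fixes f h :: "'a \<Rightarrow> 'b::real_normed_vector"
  assumes "strongly_measurable M f" "strongly_measurable M h"
  shows "strongly_measurable M (\<lambda>x. f x - h x)"
proof -
  obtain s where s: "\<forall>n. simple_function M (s n)" "AE x in M. (\<lambda>n::nat. s n x) \<longlonglongrightarrow> f x"
    using assms(1) by (auto simp: strongly_measurable_def)
  obtain s' where s': "\<forall>n. simple_function M (s' n)" "AE x in M. (\<lambda>n::nat. s' n x) \<longlonglongrightarrow> h x"
    using assms(2) by (auto simp: strongly_measurable_def)
  have "AE x in M. (\<lambda>n. s n x - s' n x) \<longlonglongrightarrow> f x - h x"
    using s(2) s'(2) by eventually_elim (rule tendsto_diff)
  moreover have "simple_function M (\<lambda>x. s n x - s' n x)" for n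
    using s(1) s'(1) by (intro simple_function_compose2[where h = "(-)"]) auto
  ultimately show ?thesis
    unfolding strongly_measurable_def by (intro exI[of _ "\<lambda>n x. s n x - s' n x"]) auto
qed

lemma has_strong_integral_cong_AE:
  assumes "has_strong_integral M f I" "AE x in M. f x = h x"
  shows "has_strong_integral M h I"
proof -
  obtain s where s: "\<forall>n::nat. Bochner_Integration.simple_bochner_integrable M (s n)"
      "(\<lambda>n. \<integral>\<^sup>+ x. ennreal (norm (f x - s n x)) \<partial>M) \<longlonglongrightarrow> 0"
      "(\<lambda>n. Bochner_Integration.simple_bochner_integral M (s n)) \<longlonglongrightarrow> I"
    using assms(1) by (auto simp: has_strong_integral_def)
  have "(\<integral>\<^sup>+ x. ennreal (norm (f x - s n x)) \<partial>M) = (\<integral>\<^sup>+ x. ennreal (norm (h x - s n x)) \<partial>M)" for n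
    by (rule nn_integral_cong_AE) (use assms(2) in \<open>auto elim: eventually_mono\<close>)
  with s show ?thesis
    using assms strongly_measurable_cong_AE[of M f h] by (auto simp: has_strong_integral_def)
qed

lemma strong_integral_cong_AE:
  assumes "AE x in M. f x = h x"
  shows "strong_integral M f = strong_integral M h"
proof -
  have "AE x in M. h x = f x"
    using assms by (auto elim: eventually_mono)
  then have "has_strong_integral M f = has_strong_integral M h"
    using assms by (intro ext iffI) (blast intro: has_strong_integral_cong_AE)+
  then show ?thesis
    by (simp add: strong_integral_def)
qed

lemma simple_function_strongly_measurable:
  "simple_function M s \<Longrightarrow> strongly_measurable M s"
  unfolding strongly_measurable_def by (intro exI[of _ "\<lambda>_. s"]) auto

lemma has_strong_integral_unique:
  assumes "has_strong_integral M f I" "has_strong_integral M f J"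
  shows "I = J"
proof -
  obtain s where s: "\<And>n::nat. Bochner_Integration.simple_bochner_integrable M (s n)"
      "(\<lambda>n. \<integral>\<^sup>+ x. ennreal (norm (f x - s n x)) \<partial>M) \<longlonglongrightarrow> 0"
      "(\<lambda>n. Bochner_Integration.simple_bochner_integral M (s n)) \<longlonglongrightarrow> I"
    using assms(1) by (auto simp: has_strong_integral_def)
  obtain r where r: "\<And>n::nat. Bochner_Integration.simple_bochner_integrable M (r n)"
      "(\<lambda>n. \<integral>\<^sup>+ x. ennreal (norm (f x - r n x)) \<partial>M) \<longlonglongrightarrow> 0"
      "(\<lambda>n. Bochner_Integration.simple_bochner_integral M (r n)) \<longlonglongrightarrow> J"
    using assms(2) by (auto simp: has_strong_integral_def)
  have f: "strongly_measurable M f"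
    using assms by (simp add: has_strong_integral_def)
  have le: "ennreal (norm (Bochner_Integration.simple_bochner_integral M (s n) - Bochner_Integration.simple_bochner_integral M (r n)))
      \<le> (\<integral>\<^sup>+ x. ennreal (norm (f x - s n x)) \<partial>M) + (\<integral>\<^sup>+ x. ennreal (norm (f x - r n x)) \<partial>M)" for n
  proof -
    have sf: "simple_function M (s n)" "simple_function M (r n)"
      using s(1) r(1) by (auto elim: simple_bochner_integrable.cases)
    obtain h where h: "h \<in> borel_measurable M" "AE x in M. norm (f x - s n x) = h x"
      using strongly_measurable_norm[OF strongly_measurable_diff[OF f simple_function_strongly_measurable[OF sf(1)]]]
      by auto
    obtain k where k: "k \<in> borel_measurable M" "AE x in M. norm (f x - r n x) = k x"
      using strongly_measurable_norm[OF strongly_measurable_diff[OF f simple_function_strongly_measurable[OF sf(2)]]]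
      by auto
    have d: "Bochner_Integration.simple_bochner_integrable M (\<lambda>x. s n x - r n x)"
      by (rule simple_bochner_integrable_compose2[where p = "(-)", OF _ s(1) r(1)]) simp
    have "Bochner_Integration.simple_bochner_integral M (s n) - Bochner_Integration.simple_bochner_integral M (r n)
        = Bochner_Integration.simple_bochner_integral M (\<lambda>x. s n x - r n x)"
      by (rule simple_bochner_integral_diff[OF s(1) r(1), symmetric])
    then have "ennreal (norm (Bochner_Integration.simple_bochner_integral M (s n) - Bochner_Integration.simple_bochner_integral M (r n)))
        \<le> ennreal (Bochner_Integration.simple_bochner_integral M (\<lambda>x. norm (s n x - r n x)))"
      using simple_bochner_integral_norm_bound[OF d] by (auto intro: ennreal_leI)
    also have "\<dots> = (\<integral>\<^sup>+ x. ennreal (norm (s n x - r n x)) \<partial>M)"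
      by (rule simple_bochner_integral_eq_nn_integral,
          rule simple_bochner_integrable_compose2[where p = "\<lambda>x y. norm (x - y)", OF _ s(1) r(1)]) auto
    also have "\<dots> \<le> (\<integral>\<^sup>+ x. ennreal (h x) + ennreal (k x) \<partial>M)"
      using h(2) k(2)
    proof (intro nn_integral_mono_AE, eventually_elim)
      fix x assume *: "norm (f x - s n x) = h x" "norm (f x - r n x) = k x"
      have "norm (s n x - r n x) \<le> norm (f x - s n x) + norm (f x - r n x)"
        using norm_triangle_ineq4[of "f x - r n x" "f x - s n x"] by simp
      moreover have "0 \<le> h x" "0 \<le> k x"
        using *[symmetric] by auto
      ultimately show "ennreal (norm (s n x - r n x)) \<le> ennreal (h x) + ennreal (k x)"
        using * by (simp flip: ennreal_plus add: ennreal_leI)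
    qed
    also have "\<dots> = (\<integral>\<^sup>+ x. ennreal (h x) \<partial>M) + (\<integral>\<^sup>+ x. ennreal (k x) \<partial>M)"
      using h(1) k(1) by (intro nn_integral_add) auto
    also have "(\<integral>\<^sup>+ x. ennreal (h x) \<partial>M) = (\<integral>\<^sup>+ x. ennreal (norm (f x - s n x)) \<partial>M)"
      by (rule nn_integral_cong_AE) (use h(2) in \<open>auto elim: eventually_mono\<close>)
    also have "(\<integral>\<^sup>+ x. ennreal (k x) \<partial>M) = (\<integral>\<^sup>+ x. ennreal (norm (f x - r n x)) \<partial>M)"
      by (rule nn_integral_cong_AE) (use k(2) in \<open>auto elim: eventually_mono\<close>)
    finally show ?thesis .
  qed
  have lim1: "(\<lambda>n. ennreal (norm (Bochner_Integration.simple_bochner_integral M (s n) - Bochner_Integration.simple_bochner_integral M (r n))))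
      \<longlonglongrightarrow> ennreal (norm (I - J))"
    by (intro tendsto_ennrealI tendsto_norm tendsto_diff s r)
  have lim2: "(\<lambda>n. (\<integral>\<^sup>+ x. ennreal (norm (f x - s n x)) \<partial>M)
      + (\<integral>\<^sup>+ x. ennreal (norm (f x - r n x)) \<partial>M)) \<longlonglongrightarrow> 0"
    using tendsto_add[OF s(2) r(2)] by simp
  have "ennreal (norm (I - J)) \<le> 0"
    by (rule LIMSEQ_le[OF lim1 lim2]) (use le in blast)
  then show ?thesis
    by (simp add: ennreal_eq_0_iff)
qed

lemma strong_integral_eq: "has_strong_integral M f I \<Longrightarrow> strong_integral M f = I"
  unfolding strong_integral_def using has_strong_integral_unique by blast

lemma has_bochner_integral_imp_strong:
  fixes f :: "'a \<Rightarrow> 'b::{banach, second_countable_topology}"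
  assumes "has_bochner_integral M f I"
  shows "has_strong_integral M f I"
proof -
  from assms have f: "f \<in> borel_measurable M"
    by (auto elim: has_bochner_integral.cases)
  obtain S where "\<And>i. simple_function M (S i)"
      "\<And>x. x \<in> space M \<Longrightarrow> (\<lambda>i. S i x) \<longlonglongrightarrow> f x"
    using borel_measurable_implies_sequence_metric[OF f, of 0] by blast
  then have "strongly_measurable M f"
    unfolding strongly_measurable_def by (intro exI[of _ S]) auto
  with assms show ?thesis
    by (auto simp: has_strong_integral_def elim!: has_bochner_integral.cases)
qed

section \<open>Bochner spaces of equivalence classes\<close>

definition Lp_fun :: "'a measure \<Rightarrow> real \<Rightarrow> ('a \<Rightarrow> 'b::real_normed_vector) set" where
  "Lp_fun M p = {f. strongly_measurable M f \<and> (\<integral>\<^sup>+ x. ennreal (norm (f x) powr p) \<partial>M) < \<infinity>}"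

definition Lp_seminorm :: "'a measure \<Rightarrow> real \<Rightarrow> ('a \<Rightarrow> 'b::real_normed_vector) \<Rightarrow> real" where
  "Lp_seminorm M p f = enn2real (\<integral>\<^sup>+ x. ennreal (norm (f x) powr p) \<partial>M) powr (1 / p)"

definition Lp_rel :: "'a measure \<Rightarrow> real \<Rightarrow> (('a \<Rightarrow> 'b::real_normed_vector) \<times> ('a \<Rightarrow> 'b)) set" where
  "Lp_rel M p = {(f, h). f \<in> Lp_fun M p \<and> h \<in> Lp_fun M p \<and> (AE x in M. f x = h x)}"

definition Lp_space :: "'a measure \<Rightarrow> real \<Rightarrow> ('a \<Rightarrow> 'b::real_normed_vector) set set" where
  "Lp_space M p = Lp_fun M p // Lp_rel M p"

definition Lp_class :: "'a measure \<Rightarrow> real \<Rightarrow> ('a \<Rightarrow> 'b::real_normed_vector) \<Rightarrow> ('a \<Rightarrow> 'b) set" where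
  "Lp_class M p f = Lp_rel M p `` {f}"

definition Lp_rep :: "('a \<Rightarrow> 'b) set \<Rightarrow> 'a \<Rightarrow> 'b" where
  "Lp_rep F = (SOME f. f \<in> F)"

definition Lp_norm :: "'a measure \<Rightarrow> real \<Rightarrow> ('a \<Rightarrow> 'b::real_normed_vector) set \<Rightarrow> real" where
  "Lp_norm M p F = Lp_seminorm M p (Lp_rep F)"

definition Lp_dist ::
    "'a measure \<Rightarrow> real \<Rightarrow> ('a \<Rightarrow> 'b::real_normed_vector) set \<Rightarrow> ('a \<Rightarrow> 'b) set \<Rightarrow> real" where
  "Lp_dist M p F H = Lp_seminorm M p (\<lambda>x. Lp_rep F x - Lp_rep H x)"

text \<open>The norm topology of \<open>L\<^sup>p\<close>; \<open>Lp_dist\<close> is a metric for \<open>p \<ge> 1\<close>, see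
  \<open>Metric_space_Lp\<close>.\<close>

definition Lp_topology :: "'a measure \<Rightarrow> real \<Rightarrow> ('a \<Rightarrow> 'b::real_normed_vector) set topology" where
  "Lp_topology M p = Metric_space.mtopology (Lp_space M p) (Lp_dist M p)"

lemma equiv_Lp_rel: "equiv (Lp_fun M p) (Lp_rel M p)"
proof (rule equivI)
  show "refl_on (Lp_fun M p) (Lp_rel M p)"
    by (auto simp: refl_on_def Lp_rel_def)
  show "sym (Lp_rel M p)"
    by (auto simp: sym_def Lp_rel_def elim: eventually_mono)
  show "trans (Lp_rel M p)"
    by (auto simp: trans_def Lp_rel_def elim: eventually_elim2)
qed (auto simp: Lp_rel_def)

lemma Lp_rep_mem: "F \<in> Lp_space M p \<Longrightarrow> Lp_rep F \<in> F"
  using in_quotient_imp_non_empty[OF equiv_Lp_rel, of F M p]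
  by (auto simp: Lp_rep_def Lp_space_def some_in_eq)

lemma Lp_space_memD:
  assumes "F \<in> Lp_space M p" "f \<in> F" "h \<in> F"
  shows "f \<in> Lp_fun M p" "AE x in M. f x = h x"
proof -
  have "(f, h) \<in> Lp_rel M p"
    by (rule in_quotient_imp_in_rel[OF equiv_Lp_rel]) (use assms in \<open>auto simp: Lp_space_def\<close>)
  then show "f \<in> Lp_fun M p" "AE x in M. f x = h x"
    by (auto simp: Lp_rel_def)
qed

lemma Lp_rep_fun: "F \<in> Lp_space M p \<Longrightarrow> Lp_rep F \<in> Lp_fun M p"
  using Lp_space_memD Lp_rep_mem by blast

lemma Lp_space_eqI:
  assumes "F \<in> Lp_space M p" "H \<in> Lp_space M p" "f \<in> F" "h \<in> H" "AE x in M. f x = h x"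
  shows "F = H"
proof (rule quotient_eqI[OF equiv_Lp_rel])
  show "(f, h) \<in> Lp_rel M p"
    using assms(5) Lp_space_memD(1)[OF assms(1,3,3)] Lp_space_memD(1)[OF assms(2,4,4)]
    by (simp add: Lp_rel_def)
qed (use assms in \<open>simp_all add: Lp_space_def\<close>)

lemma Lp_class_mem: "f \<in> Lp_fun M p \<Longrightarrow> f \<in> Lp_class M p f"
  by (auto simp: Lp_class_def Lp_rel_def)

lemma Lp_class_in_Lp_space: "f \<in> Lp_fun M p \<Longrightarrow> Lp_class M p f \<in> Lp_space M p"
  by (auto simp: Lp_class_def Lp_space_def intro: quotientI)

lemma Lp_seminorm_cong_AE:
  assumes "AE x in M. norm (f x) = norm (h x)"
  shows "Lp_seminorm M p f = Lp_seminorm M p h"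
proof -
  have "(\<integral>\<^sup>+ x. ennreal (norm (f x) powr p) \<partial>M) = (\<integral>\<^sup>+ x. ennreal (norm (h x) powr p) \<partial>M)"
    by (rule nn_integral_cong_AE) (use assms in \<open>auto elim: eventually_mono\<close>)
  then show ?thesis
    by (simp add: Lp_seminorm_def)
qed

lemma Lp_norm_eq:
  assumes "F \<in> Lp_space M p" "f \<in> F"
  shows "Lp_norm M p F = Lp_seminorm M p f"
  unfolding Lp_norm_def using Lp_space_memD(2)[OF assms(1) Lp_rep_mem[OF assms(1)] assms(2)]
  by (intro Lp_seminorm_cong_AE) (auto elim: eventually_mono)

lemma Lp_dist_eq:
  assumes "F \<in> Lp_space M p" "H \<in> Lp_space M p" "f \<in> F" "h \<in> H"
  shows "Lp_dist M p F H = Lp_seminorm M p (\<lambda>x. f x - h x)"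
  unfolding Lp_dist_def using Lp_space_memD(2)[OF assms(1) Lp_rep_mem[OF assms(1)] assms(3)]
    Lp_space_memD(2)[OF assms(2) Lp_rep_mem[OF assms(2)] assms(4)]
  by (intro Lp_seminorm_cong_AE) (auto elim: eventually_elim2)

lemma powr_add_weighted_le:
  fixes A B u v p :: real
  assumes p: "1 \<le> p" and A: "0 < A" "0 < B" and u: "0 \<le> u" "0 \<le> v"
  shows "(u + v) powr p \<le>
    (A + B) powr p * (A / (A + B) * (u / A) powr p + B / (A + B) * (v / B) powr p)"
proof -
  define l where "l = A / (A + B)"
  have l: "0 < l" "l < 1" "B / (A + B) = 1 - l"
    using A by (auto simp: l_def field_simps)
  define y z where "y = u / A" and "z = v / B"
  have yz: "0 \<le> y" "0 \<le> z"
    using A u by (auto simp: y_def z_def)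
  have small: "(c * w) powr p \<le> c * w powr p" if "0 < c" "c < 1" "0 \<le> w" for c w :: real
  proof -
    have "c powr p \<le> c powr 1"
      using that p by (intro powr_mono') auto
    with that show ?thesis
      by (simp add: powr_mult mult_right_mono)
  qed
  have conv: "(l * y + (1 - l) * z) powr p \<le> l * y powr p + (1 - l) * z powr p"
  proof (cases "y = 0 \<or> z = 0")
    case True
    then show ?thesis
      using small[of "1 - l" z] small[of l y] l p yz by auto
  next
    case False
    then show ?thesis
      using convex_onD[OF powr_convex[OF p], of "1 - l" y z] l yz by auto
  qed
  have "u + v = (A + B) * (l * y + (1 - l) * z)"
  proof -
    have "(A + B) * l = A" "(A + B) * (1 - l) = B"
      using A unfolding l(3)[symmetric] by (auto simp: l_def)
    then have "(A + B) * (l * y + (1 - l) * z) = A * y + B * z"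
      by (simp add: distrib_left mult.assoc[symmetric])
    then show ?thesis
      using A by (simp add: y_def z_def)
  qed
  then have "(u + v) powr p = (A + B) powr p * (l * y + (1 - l) * z) powr p"
    using A l yz by (simp add: powr_mult)
  also have "\<dots> \<le> (A + B) powr p * (l * y powr p + (1 - l) * z powr p)"
    using conv by (intro mult_left_mono) auto
  finally show ?thesis
    unfolding l(3) by (simp add: l_def y_def z_def)
qed

lemma Lp_Minkowski:
  fixes f h :: "'a \<Rightarrow> 'b::real_normed_vector"
  assumes p: "1 \<le> p" and f: "f \<in> Lp_fun M p" and h: "h \<in> Lp_fun M p"
  shows "Lp_seminorm M p (\<lambda>x. f x - h x) \<le> Lp_seminorm M p f + Lp_seminorm M p h"
proof (rule field_le_epsilon)
  fix e :: real assume e: "0 < e"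
  define I where "I = (\<lambda>k :: 'a \<Rightarrow> 'b. \<integral>\<^sup>+ x. ennreal (norm (k x) powr p) \<partial>M)"
  define A where "A = Lp_seminorm M p f + e / 2"
  define B where "B = Lp_seminorm M p h + e / 2"
  have AB: "0 < A" "0 < B"
    using e by (auto simp: A_def B_def Lp_seminorm_def intro!: add_nonneg_pos)
  have le: "I k \<le> ennreal (C powr p)" if "k \<in> Lp_fun M p" "Lp_seminorm M p k \<le> C" for k C
  proof -
    have "enn2real (I k) = Lp_seminorm M p k powr p"
      using p by (simp add: Lp_seminorm_def I_def powr_powr)
    also have "\<dots> \<le> C powr p"
      using that p by (intro powr_mono2) (auto simp: Lp_seminorm_def)
    finally have "ennreal (enn2real (I k)) \<le> ennreal (C powr p)"
      by (rule ennreal_leI)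
    moreover have "ennreal (enn2real (I k)) = I k"
      using that(1) by (intro ennreal_enn2real) (simp add: Lp_fun_def I_def)
    ultimately show ?thesis
      by simp
  qed
  have IA: "I f \<le> ennreal (A powr p)" and IB: "I h \<le> ennreal (B powr p)"
    using le[OF f, of A] le[OF h, of B] e by (auto simp: A_def B_def)
  obtain u where u: "u \<in> borel_measurable M" "AE x in M. norm (f x) = u x"
    using f strongly_measurable_norm[of M f] by (auto simp: Lp_fun_def)
  obtain v where v: "v \<in> borel_measurable M" "AE x in M. norm (h x) = v x"
    using h strongly_measurable_norm[of M h] by (auto simp: Lp_fun_def)
  have Iu: "I f = (\<integral>\<^sup>+ x. ennreal (u x powr p) \<partial>M)"
    unfolding I_def by (rule nn_integral_cong_AE) (use u(2) in \<open>auto elim: eventually_mono\<close>)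
  have Iv: "I h = (\<integral>\<^sup>+ x. ennreal (v x powr p) \<partial>M)"
    unfolding I_def by (rule nn_integral_cong_AE) (use v(2) in \<open>auto elim: eventually_mono\<close>)
  define \<alpha> where "\<alpha> = (A + B) powr p * (A / (A + B)) * A powr (- p)"
  define \<beta> where "\<beta> = (A + B) powr p * (B / (A + B)) * B powr (- p)"
  have ab: "0 \<le> \<alpha>" "0 \<le> \<beta>"
    using AB by (auto simp: \<alpha>_def \<beta>_def)
  have "I (\<lambda>x. f x - h x) \<le> (\<integral>\<^sup>+ x. ennreal \<alpha> * ennreal (u x powr p) + ennreal \<beta> * ennreal (v x powr p) \<partial>M)"
    unfolding I_def using u(2) v(2)
  proof (intro nn_integral_mono_AE, eventually_elim)
    fix x assume *: "norm (f x) = u x" "norm (h x) = v x"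
    have nn: "0 \<le> u x" "0 \<le> v x"
      using *[symmetric] by auto
    have "norm (f x - h x) powr p \<le> (u x + v x) powr p"
      using norm_triangle_ineq4[of "f x" "h x"] * p by (intro powr_mono2) auto
    also have "\<dots> \<le> (A + B) powr p * (A / (A + B) * (u x / A) powr p + B / (A + B) * (v x / B) powr p)"
      by (rule powr_add_weighted_le[OF p AB nn])
    also have "\<dots> = \<alpha> * u x powr p + \<beta> * v x powr p"
      using AB nn by (simp add: \<alpha>_def \<beta>_def powr_divide powr_minus field_simps)
    finally show "ennreal (norm (f x - h x) powr p)
        \<le> ennreal \<alpha> * ennreal (u x powr p) + ennreal \<beta> * ennreal (v x powr p)"
      using ab by (simp flip: ennreal_mult ennreal_plus add: ennreal_leI)
  qed
  also have "\<dots> = ennreal \<alpha> * I f + ennreal \<beta> * I h"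
    unfolding Iu Iv using u(1) v(1) by (simp add: nn_integral_add nn_integral_cmult)
  also have "\<dots> \<le> ennreal \<alpha> * ennreal (A powr p) + ennreal \<beta> * ennreal (B powr p)"
    by (intro add_mono mult_left_mono IA IB) auto
  also have "\<dots> = ennreal (\<alpha> * A powr p + \<beta> * B powr p)"
    using ab by (simp flip: ennreal_mult ennreal_plus)
  also have "\<alpha> * A powr p + \<beta> * B powr p = (A + B) powr p"
  proof -
    have "\<alpha> * A powr p = (A + B) powr p * (A / (A + B))" "\<beta> * B powr p = (A + B) powr p * (B / (A + B))"
      using AB by (auto simp: \<alpha>_def \<beta>_def powr_minus)
    then have "\<alpha> * A powr p + \<beta> * B powr p = (A + B) powr p * (A / (A + B) + B / (A + B))"
      by (simp add: distrib_left)
    also have "A / (A + B) + B / (A + B) = 1"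
      using AB by (simp flip: add_divide_distrib)
    finally show ?thesis by simp
  qed
  finally have "enn2real (I (\<lambda>x. f x - h x)) \<le> (A + B) powr p"
    by (intro enn2real_leI) auto
  then have "Lp_seminorm M p (\<lambda>x. f x - h x) \<le> ((A + B) powr p) powr (1 / p)"
    unfolding Lp_seminorm_def I_def using p by (intro powr_mono2) auto
  also have "\<dots> = A + B"
    using p AB by (simp add: powr_powr)
  finally show "Lp_seminorm M p (\<lambda>x. f x - h x) \<le> Lp_seminorm M p f + Lp_seminorm M p h + e"
    by (simp add: A_def B_def)
qed

lemma Lp_fun_diff:
  fixes f h :: "'a \<Rightarrow> 'b::real_normed_vector"
  assumes p: "1 \<le> p" and f: "f \<in> Lp_fun M p" and h: "h \<in> Lp_fun M p"
  shows "(\<lambda>x. f x - h x) \<in> Lp_fun M p"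
proof -
  obtain u where u: "u \<in> borel_measurable M" "AE x in M. norm (f x) = u x"
    using f strongly_measurable_norm[of M f] by (auto simp: Lp_fun_def)
  obtain v where v: "v \<in> borel_measurable M" "AE x in M. norm (h x) = v x"
    using h strongly_measurable_norm[of M h] by (auto simp: Lp_fun_def)
  have "(\<integral>\<^sup>+ x. ennreal (norm (f x - h x) powr p) \<partial>M)
      \<le> (\<integral>\<^sup>+ x. ennreal (2 powr p) * (ennreal (u x powr p) + ennreal (v x powr p)) \<partial>M)"
    using u(2) v(2)
  proof (intro nn_integral_mono_AE, eventually_elim)
    fix x assume *: "norm (f x) = u x" "norm (h x) = v x"
    have nn: "0 \<le> u x" "0 \<le> v x"
      using *[symmetric] by auto
    have "norm (f x - h x) powr p \<le> (u x + v x) powr p"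
      using norm_triangle_ineq4[of "f x" "h x"] * p by (intro powr_mono2) auto
    also have "\<dots> \<le> 2 powr p * (1 / 2 * u x powr p + 1 / 2 * v x powr p)"
      using powr_add_weighted_le[OF p, of 1 1 "u x" "v x"] nn by simp
    also have "\<dots> \<le> 2 powr p * (u x powr p + v x powr p)"
      by (intro mult_left_mono add_mono) auto
    finally show "ennreal (norm (f x - h x) powr p)
        \<le> ennreal (2 powr p) * (ennreal (u x powr p) + ennreal (v x powr p))"
      by (simp flip: ennreal_mult ennreal_plus add: ennreal_leI)
  qed
  also have "\<dots> = ennreal (2 powr p) *
      ((\<integral>\<^sup>+ x. ennreal (u x powr p) \<partial>M) + (\<integral>\<^sup>+ x. ennreal (v x powr p) \<partial>M))"
    using u(1) v(1) by (simp add: nn_integral_add nn_integral_cmult)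
  also have "(\<integral>\<^sup>+ x. ennreal (u x powr p) \<partial>M) = (\<integral>\<^sup>+ x. ennreal (norm (f x) powr p) \<partial>M)"
    by (rule nn_integral_cong_AE) (use u(2) in \<open>auto elim: eventually_mono\<close>)
  also have "(\<integral>\<^sup>+ x. ennreal (v x powr p) \<partial>M) = (\<integral>\<^sup>+ x. ennreal (norm (h x) powr p) \<partial>M)"
    by (rule nn_integral_cong_AE) (use v(2) in \<open>auto elim: eventually_mono\<close>)
  also have "ennreal (2 powr p) * ((\<integral>\<^sup>+ x. ennreal (norm (f x) powr p) \<partial>M)
      + (\<integral>\<^sup>+ x. ennreal (norm (h x) powr p) \<partial>M)) < \<infinity>"
    using f h by (auto simp: Lp_fun_def ennreal_mult_less_top)
  finally show ?thesis
    using f h by (auto simp: Lp_fun_def intro: strongly_measurable_diff)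
qed

lemma Lp_seminorm_eq_0_iff:
  assumes p: "1 \<le> p" and f: "f \<in> Lp_fun M p"
  shows "Lp_seminorm M p f = 0 \<longleftrightarrow> (AE x in M. f x = 0)"
proof -
  obtain u where u: "u \<in> borel_measurable M" "AE x in M. norm (f x) = u x"
    using f strongly_measurable_norm[of M f] by (auto simp: Lp_fun_def)
  have "Lp_seminorm M p f = 0 \<longleftrightarrow> (\<integral>\<^sup>+ x. ennreal (norm (f x) powr p) \<partial>M) = 0"
    using f p by (auto simp: Lp_seminorm_def Lp_fun_def enn2real_eq_0_iff)
  also have "(\<integral>\<^sup>+ x. ennreal (norm (f x) powr p) \<partial>M) = (\<integral>\<^sup>+ x. ennreal (u x powr p) \<partial>M)"
    by (rule nn_integral_cong_AE) (use u(2) in \<open>auto elim: eventually_mono\<close>)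
  also have "\<dots> = 0 \<longleftrightarrow> (AE x in M. ennreal (u x powr p) = 0)"
    using u(1) by (intro nn_integral_0_iff_AE) auto
  also have "\<dots> \<longleftrightarrow> (AE x in M. f x = 0)"
    using u(2) by (intro iffI) (auto elim!: eventually_elim2 simp: ennreal_eq_0_iff)
  finally show ?thesis .
qed

lemma Metric_space_Lp:
  assumes p: "1 \<le> p"
  shows "Metric_space (Lp_space M p :: ('a \<Rightarrow> 'b::real_normed_vector) set set) (Lp_dist M p)"
proof
  fix F G H :: "('a \<Rightarrow> 'b) set"
  show "0 \<le> Lp_dist M p F G"
    by (simp add: Lp_dist_def Lp_seminorm_def)
  show "Lp_dist M p F G = Lp_dist M p G F"
    unfolding Lp_dist_def by (intro Lp_seminorm_cong_AE) (simp add: norm_minus_commute)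
  assume F: "F \<in> Lp_space M p" and G: "G \<in> Lp_space M p"
  note rep = Lp_rep_fun[OF F] Lp_rep_fun[OF G]
  have "Lp_dist M p F G = 0 \<longleftrightarrow> (AE x in M. Lp_rep F x = Lp_rep G x)"
    unfolding Lp_dist_def using Lp_seminorm_eq_0_iff[OF p Lp_fun_diff[OF p rep]] by simp
  also have "\<dots> \<longleftrightarrow> F = G"
    using Lp_space_eqI[OF F G Lp_rep_mem[OF F] Lp_rep_mem[OF G]] by auto
  finally show "Lp_dist M p F G = 0 \<longleftrightarrow> F = G" .
  assume H: "H \<in> Lp_space M p"
  note rep3 = Lp_rep_fun[OF H]
  have "Lp_dist M p F H =
      Lp_seminorm M p (\<lambda>x. (Lp_rep F x - Lp_rep G x) - (Lp_rep H x - Lp_rep G x))"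
    unfolding Lp_dist_def by simp
  also have "\<dots> \<le> Lp_seminorm M p (\<lambda>x. Lp_rep F x - Lp_rep G x)
      + Lp_seminorm M p (\<lambda>x. Lp_rep H x - Lp_rep G x)"
    by (intro Lp_Minkowski Lp_fun_diff p rep rep3)
  also have "Lp_seminorm M p (\<lambda>x. Lp_rep H x - Lp_rep G x) = Lp_dist M p G H"
    unfolding Lp_dist_def by (intro Lp_seminorm_cong_AE) (simp add: norm_minus_commute)
  finally show "Lp_dist M p F H \<le> Lp_dist M p F G + Lp_dist M p G H"
    by (simp add: Lp_dist_def)
qed

section \<open>Reflexivity and compactness\<close>

definition reflexive_space :: "'a::real_normed_vector itself \<Rightarrow> bool" where
  "reflexive_space (_ :: 'a itself) \<longleftrightarrow>
     (\<forall>\<phi> :: ('a \<Rightarrow>\<^sub>L real) \<Rightarrow>\<^sub>L real. \<exists>x :: 'a. \<forall>f :: 'a \<Rightarrow>\<^sub>L real.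
        blinfun_apply \<phi> f = blinfun_apply f x)"

definition compact_operator :: "('a::real_normed_vector \<Rightarrow> 'b::real_normed_vector) \<Rightarrow> bool" where
  "compact_operator T \<longleftrightarrow>
     bounded_linear T \<and> (\<forall>S. bounded S \<longrightarrow> compact (closure (T ` S)))"

text \<open>The same notion for a map from a carrier \<open>W\<close> with norm \<open>nrm\<close> into a topological space that is
  not a type: it sends norm-bounded subsets of \<open>W\<close> to relatively compact ones.\<close>

definition compact_map_on :: "'w set \<Rightarrow> ('w \<Rightarrow> real) \<Rightarrow> 'y topology \<Rightarrow> ('w \<Rightarrow> 'y) \<Rightarrow> bool" where
  "compact_map_on W nrm Y f \<longleftrightarrow> f ` W \<subseteq> topspace Y \<and>
     (\<forall>S\<subseteq>W. (\<exists>C. \<forall>w\<in>S. nrm w \<le> C) \<longrightarrow> compactin Y (Y closure_of (f ` S)))"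

section \<open>The Stieltjes evolution graph\<close>

abbreviation LS_on :: "(real \<Rightarrow> real) \<Rightarrow> real \<Rightarrow> real \<Rightarrow> real measure" where
  "LS_on g a b \<equiv> restrict_space (LS_measure g) {a..<b}"

definition evolution_graph ::
    "(real \<Rightarrow> real) \<Rightarrow> real \<Rightarrow> real \<Rightarrow> real \<Rightarrow> real \<Rightarrow> ('x::banach \<Rightarrow> 'y::banach)
      \<Rightarrow> ((real \<Rightarrow> 'x) set \<times> (real \<Rightarrow> 'y) set) set" where
  "evolution_graph g a b p0 p1 i01 =
     {(U, Z). U \<in> Lp_space (LS_on g a b) p0 \<and> Z \<in> Lp_space (LS_on g a b) p1 \<and>
        (\<exists>u\<in>U. \<exists>z\<in>Z. \<exists>x. AE t in LS_on g a b.
            i01 (u t) = x + strong_integral (LS_on g a t) z)}"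

definition evolution_norm ::
    "(real \<Rightarrow> real) \<Rightarrow> real \<Rightarrow> real \<Rightarrow> real \<Rightarrow> real
      \<Rightarrow> (real \<Rightarrow> 'x::banach) set \<times> (real \<Rightarrow> 'y::banach) set \<Rightarrow> real" where
  "evolution_norm g a b p0 p1 w =
     Lp_norm (LS_on g a b) p0 (fst w) + Lp_norm (LS_on g a b) p1 (snd w)"

text \<open>The first component, regarded as a class of functions with values in the larger space through
  the embedding \<open>i\<close>.\<close>

definition state_projection ::
    "(real \<Rightarrow> real) \<Rightarrow> real \<Rightarrow> real \<Rightarrow> real \<Rightarrow> ('x::banach \<Rightarrow> 'v::banach)
      \<Rightarrow> (real \<Rightarrow> 'x) set \<times> (real \<Rightarrow> 'y::banach) set \<Rightarrow> (real \<Rightarrow> 'v) set" where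
  "state_projection g a b p0 i w = Lp_class (LS_on g a b) p0 (i \<circ> Lp_rep (fst w))"

lemma evolution_graph_any_representative:
  assumes "(U, Z) \<in> evolution_graph g a b p0 p1 i01" "u \<in> U" "z \<in> Z"
  shows "\<exists>x. AE t in LS_on g a b. i01 (u t) = x + strong_integral (LS_on g a t) z"
proof -
  obtain u' z' x where UZ: "U \<in> Lp_space (LS_on g a b) p0" "Z \<in> Lp_space (LS_on g a b) p1"
    and mem: "u' \<in> U" "z' \<in> Z"
    and ae: "AE t in LS_on g a b. i01 (u' t) = x + strong_integral (LS_on g a t) z'"
    using assms(1) by (auto simp: evolution_graph_def)
  have eq: "strong_integral (LS_on g a t) z' = strong_integral (LS_on g a t) z"
    if "t \<in> {a..<b}" for t
  proof (rule strong_integral_cong_AE)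
    have "AE r in LS_on g a b. z' r = z r"
      by (rule Lp_space_memD(2)[OF UZ(2) mem(2) assms(3)])
    then have "AE r in LS_measure g. r \<in> {a..<b} \<longrightarrow> z' r = z r"
      by (subst (asm) AE_restrict_space_iff) auto
    then show "AE r in LS_on g a t. z' r = z r"
      using that by (subst AE_restrict_space_iff) (auto elim: eventually_mono)
  qed
  have "AE t in LS_on g a b. u' t = u t"
    by (rule Lp_space_memD(2)[OF UZ(1) mem(1) assms(2)])
  moreover have "AE t in LS_on g a b. t \<in> {a..<b}"
    by (subst AE_restrict_space_iff) auto
  moreover note ae
  ultimately have "AE t in LS_on g a b. i01 (u t) = x + strong_integral (LS_on g a t) z"
    by eventually_elim (simp add: eq)
  then show ?thesis ..
qed

end

theory Submission
  imports Defs
begin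

text \<open>
  Compactness follows from total boundedness, as the Bochner space over \<open>B\<close> is complete
  (\<open>mcomplete_Lp\<close>). Total boundedness comes from two sources.

  The first is an equicontinuity of the functions \<open>i\<^sub>0\<^sub>1 u\<close> in \<open>B\<^sub>1\<close>. They are indefinite
  integrals of functions \<open>z\<close> that are bounded in \<open>L\<^sup>p\<close> for some \<open>p > 1\<close> and therefore uniformly
  integrable, so their increments from \<open>s\<close> to \<open>t\<close> are small whenever \<open>g t - g s\<close> is small, uniformly
  over the given bounded set (\<open>norm_strong_integral_increment_le\<close>). The function \<open>g\<close> may jump and the
  functions need not be continuous in \<open>t\<close>; but splitting the interval into finitely many classes on
  which \<open>g\<close> is nearly constant, the functions are nearly constant on each class. On a class of
  positive measure, \<open>u\<close> cannot be large in \<open>B\<^sub>0\<close> everywhere, as it is bounded in \<open>L\<^sup>p\<close>.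
  Hence the near-constant value of \<open>i\<^sub>0\<^sub>1 u\<close> can be read off at a point where \<open>u\<close> is bounded
  in \<open>B\<^sub>0\<close>, and it lies near a fixed compact set. So finitely many step functions approximate all
  functions \<open>i\<^sub>0\<^sub>1 u\<close> uniformly almost everywhere (\<open>evolution_states_finite_net\<close>).

  The second is Ehrling's inequality (\<open>Ehrling\<close>): the norm of \<open>B\<close> is bounded by a small multiple of
  the norm of \<open>B\<^sub>0\<close> plus a large multiple of the norm of \<open>B\<^sub>1\<close>. It turns closeness in \<open>B\<^sub>1\<close>
  together with boundedness in \<open>B\<^sub>0\<close> into closeness in \<open>B\<close> (\<open>mtotally_bounded_state_projection\<close>).

  The values lie in Banach spaces that may be nonseparable, so the integrals and \<open>L\<^sup>p\<close> spaces of
  strongly measurable functions are developed from approximation by simple functions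
  (\<open>Lp_fun_simple_approx\<close>).
\<close>

section \<open>Strong integrals\<close>

lemma strongly_measurable_continuous_image:
  assumes "continuous_on UNIV T" "strongly_measurable M f"
  shows "strongly_measurable M (\<lambda>x. T (f x))"
proof -
  obtain s where s: "\<forall>n. simple_function M (s n)" "AE x in M. (\<lambda>n::nat. s n x) \<longlonglongrightarrow> f x"
    using assms(2) by (auto simp: strongly_measurable_def)
  have "AE x in M. (\<lambda>n. T (s n x)) \<longlonglongrightarrow> T (f x)"
    using s(2) by eventually_elim (rule continuous_on_tendsto_compose[OF assms(1)], auto)
  moreover have "simple_function M (\<lambda>x. T (s n x))" for n
    using s(1) simple_function_compose1 by blast
  ultimately show ?thesis
    unfolding strongly_measurable_def by (intro exI[of _ "\<lambda>n x. T (s n x)"]) simp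
qed

lemma strongly_measurable_indicator_scaleR:
  fixes f :: "'a \<Rightarrow> 'b::real_normed_vector"
  assumes "strongly_measurable M f" "A \<in> sets M"
  shows "strongly_measurable M (\<lambda>x. indicator A x *\<^sub>R f x)"
proof -
  obtain s where s: "\<forall>n. simple_function M (s n)" "AE x in M. (\<lambda>n::nat. s n x) \<longlonglongrightarrow> f x"
    using assms(1) by (auto simp: strongly_measurable_def)
  have "AE x in M. (\<lambda>n. indicator A x *\<^sub>R s n x) \<longlonglongrightarrow> indicator A x *\<^sub>R f x"
    using s(2) by eventually_elim (intro tendsto_intros)
  moreover have "simple_function M (\<lambda>x. (indicator A x :: real) *\<^sub>R s n x)" for n
    using s(1) assms(2)
    by (intro simple_function_compose2[where h = scaleR] simple_function_indicator) auto
  ultimately show ?thesis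
    unfolding strongly_measurable_def by (intro exI[of _ "\<lambda>n x. indicator A x *\<^sub>R s n x"]) simp
qed

text \<open>The integrands are not assumed Borel measurable, so the additivity of the nonnegative
  integral is applied to Borel measurable versions of the two norms.\<close>

lemma nn_integral_norm_le_add:
  fixes f :: "'a \<Rightarrow> 'b::real_normed_vector" and h :: "'a \<Rightarrow> 'c::real_normed_vector"
  assumes f: "strongly_measurable M f" and h: "strongly_measurable M h"
    and le: "\<And>x. norm (k x) \<le> norm (f x) + norm (h x)"
  shows "(\<integral>\<^sup>+ x. ennreal (norm (k x)) \<partial>M)
    \<le> (\<integral>\<^sup>+ x. ennreal (norm (f x)) \<partial>M) + (\<integral>\<^sup>+ x. ennreal (norm (h x)) \<partial>M)"
proof -
  obtain u where u: "u \<in> borel_measurable M" "AE x in M. norm (f x) = u x"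
    using f strongly_measurable_norm by blast
  obtain v where v: "v \<in> borel_measurable M" "AE x in M. norm (h x) = v x"
    using h strongly_measurable_norm by blast
  have "(\<integral>\<^sup>+ x. ennreal (norm (k x)) \<partial>M) \<le> (\<integral>\<^sup>+ x. ennreal (u x) + ennreal (v x) \<partial>M)"
    using u(2) v(2)
  proof (intro nn_integral_mono_AE, eventually_elim)
    fix x assume *: "norm (f x) = u x" "norm (h x) = v x"
    show "ennreal (norm (k x)) \<le> ennreal (u x) + ennreal (v x)"
      using le[of x] by (simp flip: ennreal_plus * add: ennreal_leI)
  qed
  also have "\<dots> = (\<integral>\<^sup>+ x. ennreal (u x) \<partial>M) + (\<integral>\<^sup>+ x. ennreal (v x) \<partial>M)"
    using u(1) v(1) by (intro nn_integral_add) auto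
  also have "(\<integral>\<^sup>+ x. ennreal (u x) \<partial>M) = (\<integral>\<^sup>+ x. ennreal (norm (f x)) \<partial>M)"
    by (rule nn_integral_cong_AE) (use u(2) in \<open>auto elim: eventually_mono\<close>)
  also have "(\<integral>\<^sup>+ x. ennreal (v x) \<partial>M) = (\<integral>\<^sup>+ x. ennreal (norm (h x)) \<partial>M)"
    by (rule nn_integral_cong_AE) (use v(2) in \<open>auto elim: eventually_mono\<close>)
  finally show ?thesis .
qed

lemma nn_integral_powr_finite_cmult:
  fixes h :: "'a \<Rightarrow> real"
  assumes "h \<in> borel_measurable M" "(\<integral>\<^sup>+ x. ennreal (\<bar>h x\<bar> powr p) \<partial>M) < \<infinity>" "0 \<le> c"
  shows "(\<integral>\<^sup>+ x. ennreal ((c * \<bar>h x\<bar>) powr p) \<partial>M) < \<infinity>"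
proof -
  have "(\<integral>\<^sup>+ x. ennreal ((c * \<bar>h x\<bar>) powr p) \<partial>M)
      = (\<integral>\<^sup>+ x. ennreal (c powr p) * ennreal (\<bar>h x\<bar> powr p) \<partial>M)"
    using assms(3) by (intro nn_integral_cong) (simp add: powr_mult ennreal_mult)
  also have "\<dots> = ennreal (c powr p) * (\<integral>\<^sup>+ x. ennreal (\<bar>h x\<bar> powr p) \<partial>M)"
    using assms(1) by (intro nn_integral_cmult) auto
  also have "\<dots> < \<infinity>"
    using assms(2) by (simp add: ennreal_mult_less_top)
  finally show ?thesis .
qed

text \<open>Almost everywhere limits of simple functions need not converge in \<open>L\<^sup>p\<close>. Cutting each
  simple function off where its norm exceeds twice that of \<open>f\<close> keeps pointwise convergence,
  because the cutoff is eventually inactive wherever \<open>f\<close> does not vanish, and bounds the error by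
  \<open>3 * norm f\<close>, so that dominated convergence applies.\<close>

lemma Lp_fun_simple_approx:
  fixes f :: "'a \<Rightarrow> 'b::real_normed_vector"
  assumes p: "0 < p" and f: "f \<in> Lp_fun M p"
  obtains s where "\<And>n::nat. simple_function M (s n)" "\<And>n. s n \<in> Lp_fun M p"
    "(\<lambda>n. \<integral>\<^sup>+ x. ennreal (norm (f x - s n x) powr p) \<partial>M) \<longlonglongrightarrow> 0"
proof -
  have fm: "strongly_measurable M f"
    using f by (simp add: Lp_fun_def)
  obtain r where r: "\<And>n. simple_function M (r n)" "AE x in M. (\<lambda>n::nat. r n x) \<longlonglongrightarrow> f x"
    using fm by (auto simp: strongly_measurable_def)
  obtain h where h[measurable]: "h \<in> borel_measurable M" and hf: "AE x in M. norm (f x) = h x"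
    using fm strongly_measurable_norm by blast
  have [measurable]: "(\<lambda>x. norm (r n x)) \<in> borel_measurable M" for n
    using r(1) simple_function_compose1[of M "r n" norm]
    by (intro borel_measurable_simple_function) auto
  define s where "s n x = (if norm (r n x) \<le> 2 * h x then r n x else 0)" for n x
  have simple: "simple_function M (s n)" for n
    unfolding s_def by (intro simple_function_If r) auto
  have bound: "norm (s n x) \<le> 2 * \<bar>h x\<bar>" for n x
    by (auto simp: s_def)
  have "(\<integral>\<^sup>+ x. ennreal (\<bar>h x\<bar> powr p) \<partial>M) = (\<integral>\<^sup>+ x. ennreal (norm (f x) powr p) \<partial>M)"
  proof (rule nn_integral_cong_AE)
    show "AE x in M. ennreal (\<bar>h x\<bar> powr p) = ennreal (norm (f x) powr p)"
      using hf
    proof eventually_elim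
      fix x assume *: "norm (f x) = h x"
      then have "0 \<le> h x"
        by (metis norm_ge_zero)
      with * show "ennreal (\<bar>h x\<bar> powr p) = ennreal (norm (f x) powr p)"
        by simp
    qed
  qed
  then have fin: "(\<integral>\<^sup>+ x. ennreal (\<bar>h x\<bar> powr p) \<partial>M) < \<infinity>"
    using f by (simp add: Lp_fun_def)
  have Lp: "s n \<in> Lp_fun M p" for n
  proof -
    have "(\<integral>\<^sup>+ x. ennreal (norm (s n x) powr p) \<partial>M) \<le> (\<integral>\<^sup>+ x. ennreal ((2 * \<bar>h x\<bar>) powr p) \<partial>M)"
      using p bound by (intro nn_integral_mono ennreal_leI powr_mono2) auto
    also have "\<dots> < \<infinity>"
      by (rule nn_integral_powr_finite_cmult[OF h fin]) simp
    finally show ?thesis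
      using simple_function_strongly_measurable[OF simple] by (simp add: Lp_fun_def)
  qed
  have "\<exists>v. v \<in> borel_measurable M \<and> (AE x in M. norm (f x - s n x) = v x)" for n
    using strongly_measurable_norm[OF strongly_measurable_diff[OF fm
        simple_function_strongly_measurable[OF simple[of n]]]] by blast
  then obtain v where [measurable]: "\<And>n. v n \<in> borel_measurable M"
    and v: "\<And>n. AE x in M. norm (f x - s n x) = v n x"
    by metis
  have v_all: "AE x in M. \<forall>n. norm (f x - s n x) = v n x"
    using v by (simp add: AE_all_countable)
  \<comment> \<open>At zeros of \<open>f\<close> the cutoff forces \<open>s n x = 0\<close>; elsewhere it is eventually inactive.\<close>
  have s_lim: "(\<lambda>n. s n x) \<longlonglongrightarrow> f x" if "(\<lambda>n. r n x) \<longlonglongrightarrow> f x" "norm (f x) = h x" for x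
  proof (cases "f x = 0")
    case True
    then have "s n x = 0" for n
      using that(2) by (auto simp: s_def)
    then show ?thesis using True by simp
  next
    case False
    have "(\<lambda>n. norm (r n x)) \<longlonglongrightarrow> norm (f x)"
      by (intro tendsto_norm that)
    then have "eventually (\<lambda>n. norm (r n x) < 2 * norm (f x)) sequentially"
      by (rule order_tendstoD(2)) (use False in simp)
    then have "eventually (\<lambda>n. r n x = s n x) sequentially"
      by eventually_elim (use that(2) in \<open>simp add: s_def\<close>)
    then show ?thesis
      by (rule Lim_transform_eventually[OF that(1)])
  qed
  have "(\<lambda>n. \<integral>\<^sup>+ x. ennreal (v n x powr p) \<partial>M) \<longlonglongrightarrow> (\<integral>\<^sup>+ x. 0 \<partial>M)"
  proof (rule nn_integral_dominated_convergence[where w = "\<lambda>x. ennreal ((3 * \<bar>h x\<bar>) powr p)"])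
    show "AE x in M. ennreal (v n x powr p) \<le> ennreal ((3 * \<bar>h x\<bar>) powr p)" for n
      using v hf
    proof eventually_elim
      fix x assume "norm (f x - s n x) = v n x" "norm (f x) = h x"
      moreover have "norm (f x - s n x) \<le> norm (f x) + norm (s n x)"
        by (rule norm_triangle_ineq4)
      ultimately have "0 \<le> v n x" "v n x \<le> 3 * \<bar>h x\<bar>"
        using bound[of n x] norm_ge_zero[of "f x - s n x"] by linarith+
      then show "ennreal (v n x powr p) \<le> ennreal ((3 * \<bar>h x\<bar>) powr p)"
        using p by (intro ennreal_leI powr_mono2) auto
    qed
    show "(\<integral>\<^sup>+ x. ennreal ((3 * \<bar>h x\<bar>) powr p) \<partial>M) < \<infinity>"
      by (rule nn_integral_powr_finite_cmult[OF h fin]) simp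
    show "AE x in M. (\<lambda>n. ennreal (v n x powr p)) \<longlonglongrightarrow> 0"
      using v_all r(2) hf
    proof eventually_elim
      fix x assume *: "\<forall>n. norm (f x - s n x) = v n x" "(\<lambda>n. r n x) \<longlonglongrightarrow> f x" "norm (f x) = h x"
      have "(\<lambda>n. norm (f x - s n x)) \<longlonglongrightarrow> norm (f x - f x)"
        by (intro tendsto_intros s_lim *)
      then have "(\<lambda>n. norm (f x - s n x) powr p) \<longlonglongrightarrow> 0"
        using p by (intro tendsto_zero_powrI[where b = p]) auto
      then show "(\<lambda>n. ennreal (v n x powr p)) \<longlonglongrightarrow> 0"
        using * tendsto_ennrealI[of _ 0] by simp
    qed
  qed auto
  moreover have "(\<integral>\<^sup>+ x. ennreal (v n x powr p) \<partial>M) = (\<integral>\<^sup>+ x. ennreal (norm (f x - s n x) powr p) \<partial>M)" for n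
    by (rule nn_integral_cong_AE) (use v[of n] in \<open>auto elim!: eventually_mono\<close>)
  ultimately show thesis
    using that[of s] simple Lp by simp
qed

lemma norm_simple_bochner_integral_diff_le:
  fixes s t :: "'a \<Rightarrow> 'b::real_normed_vector"
  assumes s: "Bochner_Integration.simple_bochner_integrable M s"
    and t: "Bochner_Integration.simple_bochner_integrable M t"
  shows "ennreal (norm (Bochner_Integration.simple_bochner_integral M s
      - Bochner_Integration.simple_bochner_integral M t)) \<le> (\<integral>\<^sup>+ x. ennreal (norm (s x - t x)) \<partial>M)"
proof -
  have d: "Bochner_Integration.simple_bochner_integrable M (\<lambda>x. s x - t x)"
    by (rule simple_bochner_integrable_compose2[where p = "(-)", OF _ s t]) simp
  have "ennreal (norm (Bochner_Integration.simple_bochner_integral M s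
      - Bochner_Integration.simple_bochner_integral M t))
      \<le> ennreal (Bochner_Integration.simple_bochner_integral M (\<lambda>x. norm (s x - t x)))"
    using simple_bochner_integral_norm_bound[OF d] simple_bochner_integral_diff[OF s t]
    by (auto intro: ennreal_leI)
  also have "\<dots> = (\<integral>\<^sup>+ x. ennreal (norm (s x - t x)) \<partial>M)"
    by (rule simple_bochner_integral_eq_nn_integral,
        rule simple_bochner_integrable_compose2[where p = "\<lambda>x y. norm (x - y)", OF _ s t]) auto
  finally show ?thesis .
qed

lemma simple_bochner_integrable_strongly_measurable:
  "Bochner_Integration.simple_bochner_integrable M s \<Longrightarrow> strongly_measurable M s"
  by (auto elim: simple_bochner_integrable.cases intro: simple_function_strongly_measurable)

text \<open>Bochner's criterion. The integrals of \<open>L\<^sup>1\<close> approximations by simple functions form a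
  Cauchy sequence, because those of two approximations differ in norm by at most the sum of
  their distances to \<open>f\<close>.\<close>

lemma has_strong_integral_exists:
  fixes f :: "'a \<Rightarrow> 'b::banach"
  assumes f: "strongly_measurable M f" and fin: "(\<integral>\<^sup>+ x. ennreal (norm (f x)) \<partial>M) < \<infinity>"
  shows "\<exists>I. has_strong_integral M f I"
proof -
  have "f \<in> Lp_fun M 1"
    using assms by (simp add: Lp_fun_def)
  then obtain s where s: "\<And>n::nat. simple_function M (s n)" "\<And>n. s n \<in> Lp_fun M 1"
    and "(\<lambda>n. \<integral>\<^sup>+ x. ennreal (norm (f x - s n x) powr 1) \<partial>M) \<longlonglongrightarrow> 0"
    using Lp_fun_simple_approx[of 1 f M] by auto
  then have lim: "(\<lambda>n. \<integral>\<^sup>+ x. ennreal (norm (f x - s n x)) \<partial>M) \<longlonglongrightarrow> 0"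
    by simp
  have sbi: "Bochner_Integration.simple_bochner_integrable M (s n)" for n
    using s[of n] by (intro simple_bochner_integrableI_bounded) (auto simp: Lp_fun_def)
  let ?S = "\<lambda>n. Bochner_Integration.simple_bochner_integral M (s n)"
  have le: "ennreal (norm (?S m - ?S n)) \<le> (\<integral>\<^sup>+ x. ennreal (norm (f x - s m x)) \<partial>M)
      + (\<integral>\<^sup>+ x. ennreal (norm (f x - s n x)) \<partial>M)" for m n
  proof -
    have "norm (s m x - s n x) \<le> norm (f x - s m x) + norm (f x - s n x)" for x
      using norm_triangle_ineq4[of "f x - s n x" "f x - s m x"] by simp
    then have "(\<integral>\<^sup>+ x. ennreal (norm (s m x - s n x)) \<partial>M) \<le> (\<integral>\<^sup>+ x. ennreal (norm (f x - s m x)) \<partial>M)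
      + (\<integral>\<^sup>+ x. ennreal (norm (f x - s n x)) \<partial>M)"
      by (intro nn_integral_norm_le_add strongly_measurable_diff f
          simple_function_strongly_measurable s)
    then show ?thesis
      using norm_simple_bochner_integral_diff_le[OF sbi[of m] sbi[of n]] by (rule order_trans[rotated])
  qed
  have "Cauchy ?S"
  proof (rule CauchyI)
    fix e :: real assume e: "0 < e"
    then have "eventually (\<lambda>n. (\<integral>\<^sup>+ x. ennreal (norm (f x - s n x)) \<partial>M) < ennreal (e / 2)) sequentially"
      by (intro order_tendstoD(2)[OF lim]) simp
    then obtain N where N: "\<And>n. n \<ge> N \<Longrightarrow> (\<integral>\<^sup>+ x. ennreal (norm (f x - s n x)) \<partial>M) < ennreal (e / 2)"
      by (auto simp: eventually_sequentially)
    show "\<exists>N. \<forall>m\<ge>N. \<forall>n\<ge>N. norm (?S m - ?S n) < e"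
    proof (intro exI[of _ N] allI impI)
      fix m n assume "m \<ge> N" "n \<ge> N"
      then have "ennreal (norm (?S m - ?S n)) < ennreal (e / 2) + ennreal (e / 2)"
        by (intro order_le_less_trans[OF le] add_strict_mono N)
      also have "\<dots> = ennreal e"
        using e by (simp flip: ennreal_plus)
      finally show "norm (?S m - ?S n) < e"
        by (simp add: ennreal_less_iff)
    qed
  qed
  then obtain I where "?S \<longlonglongrightarrow> I"
    using Cauchy_convergent convergentD by blast
  then show ?thesis
    using f sbi lim by (auto simp: has_strong_integral_def)
qed

lemma norm_has_strong_integral_le:
  assumes "has_strong_integral M f I"
  shows "ennreal (norm I) \<le> (\<integral>\<^sup>+ x. ennreal (norm (f x)) \<partial>M)"
proof -
  obtain s where s: "\<And>n::nat. Bochner_Integration.simple_bochner_integrable M (s n)"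
      "(\<lambda>n. \<integral>\<^sup>+ x. ennreal (norm (f x - s n x)) \<partial>M) \<longlonglongrightarrow> 0"
      "(\<lambda>n. Bochner_Integration.simple_bochner_integral M (s n)) \<longlonglongrightarrow> I"
    and f: "strongly_measurable M f"
    using assms by (auto simp: has_strong_integral_def)
  have zero: "Bochner_Integration.simple_bochner_integrable M (\<lambda>_. 0 :: 'b)"
    by (auto intro: simple_bochner_integrable.intros)
  have le: "ennreal (norm (Bochner_Integration.simple_bochner_integral M (s n)))
      \<le> (\<integral>\<^sup>+ x. ennreal (norm (f x)) \<partial>M) + (\<integral>\<^sup>+ x. ennreal (norm (f x - s n x)) \<partial>M)" for n
  proof -
    have "norm (s n x) \<le> norm (f x) + norm (f x - s n x)" for x
      using norm_triangle_ineq4[of "f x" "f x - s n x"] by simp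
    then have "(\<integral>\<^sup>+ x. ennreal (norm (s n x)) \<partial>M)
        \<le> (\<integral>\<^sup>+ x. ennreal (norm (f x)) \<partial>M) + (\<integral>\<^sup>+ x. ennreal (norm (f x - s n x)) \<partial>M)"
      by (intro nn_integral_norm_le_add strongly_measurable_diff f
          simple_bochner_integrable_strongly_measurable s)
    moreover have "Bochner_Integration.simple_bochner_integral M (\<lambda>_. 0 :: 'b) = 0"
      by (auto simp: simple_bochner_integral_def intro!: sum.neutral)
    ultimately show ?thesis
      using norm_simple_bochner_integral_diff_le[OF s(1)[of n] zero] by (auto intro: order_trans)
  qed
  have lim1: "(\<lambda>n. ennreal (norm (Bochner_Integration.simple_bochner_integral M (s n)))) \<longlonglongrightarrow> ennreal (norm I)"
    by (intro tendsto_ennrealI tendsto_norm s)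
  have lim2: "(\<lambda>n. (\<integral>\<^sup>+ x. ennreal (norm (f x)) \<partial>M) + (\<integral>\<^sup>+ x. ennreal (norm (f x - s n x)) \<partial>M))
      \<longlonglongrightarrow> (\<integral>\<^sup>+ x. ennreal (norm (f x)) \<partial>M) + 0"
    by (intro tendsto_add tendsto_const s)
  have "ennreal (norm I) \<le> (\<integral>\<^sup>+ x. ennreal (norm (f x)) \<partial>M) + 0"
    by (rule LIMSEQ_le[OF lim1 lim2]) (use le in blast)
  then show ?thesis
    by simp
qed

lemma has_strong_integral_diff:
  assumes "has_strong_integral M f I" "has_strong_integral M h J"
  shows "has_strong_integral M (\<lambda>x. f x - h x) (I - J)"
proof -
  obtain s where s: "\<And>n::nat. Bochner_Integration.simple_bochner_integrable M (s n)"
      "(\<lambda>n. \<integral>\<^sup>+ x. ennreal (norm (f x - s n x)) \<partial>M) \<longlonglongrightarrow> 0"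
      "(\<lambda>n. Bochner_Integration.simple_bochner_integral M (s n)) \<longlonglongrightarrow> I"
    and f: "strongly_measurable M f"
    using assms(1) by (auto simp: has_strong_integral_def)
  obtain t where t: "\<And>n::nat. Bochner_Integration.simple_bochner_integrable M (t n)"
      "(\<lambda>n. \<integral>\<^sup>+ x. ennreal (norm (h x - t n x)) \<partial>M) \<longlonglongrightarrow> 0"
      "(\<lambda>n. Bochner_Integration.simple_bochner_integral M (t n)) \<longlonglongrightarrow> J"
    and h: "strongly_measurable M h"
    using assms(2) by (auto simp: has_strong_integral_def)
  have le: "(\<integral>\<^sup>+ x. ennreal (norm ((f x - h x) - (s n x - t n x))) \<partial>M)
      \<le> (\<integral>\<^sup>+ x. ennreal (norm (f x - s n x)) \<partial>M) + (\<integral>\<^sup>+ x. ennreal (norm (h x - t n x)) \<partial>M)" for n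
  proof (intro nn_integral_norm_le_add strongly_measurable_diff f h
      simple_bochner_integrable_strongly_measurable s t)
    show "norm ((f x - h x) - (s n x - t n x)) \<le> norm (f x - s n x) + norm (h x - t n x)" for x
      using norm_triangle_ineq4[of "f x - s n x" "h x - t n x"] by (simp add: algebra_simps)
  qed
  have "(\<lambda>n. (\<integral>\<^sup>+ x. ennreal (norm (f x - s n x)) \<partial>M) + (\<integral>\<^sup>+ x. ennreal (norm (h x - t n x)) \<partial>M))
      \<longlonglongrightarrow> 0 + 0"
    by (intro tendsto_add s t)
  then have lim: "(\<lambda>n. (\<integral>\<^sup>+ x. ennreal (norm (f x - s n x)) \<partial>M) + (\<integral>\<^sup>+ x. ennreal (norm (h x - t n x)) \<partial>M))
      \<longlonglongrightarrow> 0"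
    by simp
  have "(\<lambda>n. \<integral>\<^sup>+ x. ennreal (norm ((f x - h x) - (s n x - t n x))) \<partial>M) \<longlonglongrightarrow> 0"
    by (rule tendsto_sandwich[OF _ _ tendsto_const lim]) (use le in simp_all)
  moreover have "Bochner_Integration.simple_bochner_integrable M (\<lambda>x. s n x - t n x)" for n
    by (rule simple_bochner_integrable_compose2[where p = "(-)", OF _ s(1) t(1)]) simp
  moreover have "(\<lambda>n. Bochner_Integration.simple_bochner_integral M (\<lambda>x. s n x - t n x)) \<longlonglongrightarrow> I - J"
    using tendsto_diff[OF s(3) t(3)] by (simp add: simple_bochner_integral_diff[OF s(1) t(1)])
  ultimately show ?thesis
    using strongly_measurable_diff[OF f h] unfolding has_strong_integral_def
    by (intro conjI exI[of _ "\<lambda>n x. s n x - t n x"]) auto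
qed

lemma has_strong_integral_simple:
  assumes "Bochner_Integration.simple_bochner_integrable M s"
  shows "has_strong_integral M s (Bochner_Integration.simple_bochner_integral M s)"
  using assms simple_bochner_integrable_strongly_measurable[OF assms]
  unfolding has_strong_integral_def by (intro conjI exI[of _ "\<lambda>_. s"]) auto

text \<open>The simple functions approximating \<open>indicator A *\<^sub>R f\<close> may be nonzero outside of \<open>A\<close>. Cutting
  them off there only improves the approximation, and it makes their integrals over the whole space
  and over \<open>A\<close> agree.\<close>

lemma has_strong_integral_restrict_space:
  fixes f :: "'a \<Rightarrow> 'b::real_normed_vector"
  assumes I: "has_strong_integral M (\<lambda>x. indicator A x *\<^sub>R f x) I" and A: "A \<in> sets M"
  shows "has_strong_integral (restrict_space M A) f I"
proof -
  have A': "A \<inter> space M \<in> sets M"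
    using A by auto
  let ?f = "\<lambda>x. indicator A x *\<^sub>R f x"
  obtain s where s: "\<And>n::nat. Bochner_Integration.simple_bochner_integrable M (s n)"
      "(\<lambda>n. \<integral>\<^sup>+ x. ennreal (norm (?f x - s n x)) \<partial>M) \<longlonglongrightarrow> 0"
    using I by (auto simp: has_strong_integral_def)
  let ?t = "\<lambda>n x. (indicator A x :: real) *\<^sub>R s n x"
  have t: "Bochner_Integration.simple_bochner_integrable M (?t n)" for n
  proof
    show "simple_function M (?t n)"
      using s(1)[of n] A by (intro simple_function_compose2[where h = scaleR] simple_function_indicator)
         (auto elim: simple_bochner_integrable.cases)
    have sf: "simple_function M (s n)" "emeasure M {x \<in> space M. s n x \<noteq> 0} \<noteq> \<infinity>"
      using s(1)[of n] by (auto elim: simple_bochner_integrable.cases)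
    have "emeasure M {x \<in> space M. ?t n x \<noteq> 0} \<le> emeasure M {x \<in> space M. s n x \<noteq> 0}"
      using simple_functionD(2)[OF sf(1), of "- {0}"]
      by (intro emeasure_mono) (auto simp: vimage_def Int_def conj_commute)
    then show "emeasure M {x \<in> space M. ?t n x \<noteq> 0} \<noteq> \<infinity>"
      using sf(2) by (auto simp: top_unique)
  qed
  have le: "(\<integral>\<^sup>+ x. ennreal (norm (?f x - ?t n x)) \<partial>M) \<le> (\<integral>\<^sup>+ x. ennreal (norm (?f x - s n x)) \<partial>M)" for n
    by (intro nn_integral_mono ennreal_leI) (simp split: split_indicator)
  have lim: "(\<lambda>n. \<integral>\<^sup>+ x. ennreal (norm (?f x - ?t n x)) \<partial>M) \<longlonglongrightarrow> 0"
    by (rule tendsto_sandwich[OF _ _ tendsto_const s(2)]) (use le in auto)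
  have "(\<lambda>n. ennreal (norm (Bochner_Integration.simple_bochner_integral M (?t n) - I))) \<longlonglongrightarrow> 0"
  proof (rule tendsto_sandwich[OF _ _ tendsto_const lim])
    have "ennreal (norm (I - Bochner_Integration.simple_bochner_integral M (?t n)))
        \<le> (\<integral>\<^sup>+ x. ennreal (norm (?f x - ?t n x)) \<partial>M)" for n
      by (rule norm_has_strong_integral_le[OF has_strong_integral_diff[OF I has_strong_integral_simple[OF t]]])
    then show "\<forall>\<^sub>F n in sequentially. ennreal (norm (Bochner_Integration.simple_bochner_integral M (?t n) - I))
        \<le> (\<integral>\<^sup>+ x. ennreal (norm (?f x - ?t n x)) \<partial>M)"
      by (simp add: norm_minus_commute)
  qed simp
  then have "(\<lambda>n. norm (Bochner_Integration.simple_bochner_integral M (?t n) - I)) \<longlonglongrightarrow> 0"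
    using tendsto_ennreal_iff[of _ sequentially 0] by simp
  then have tI: "(\<lambda>n. Bochner_Integration.simple_bochner_integral M (?t n)) \<longlonglongrightarrow> I"
    by (rule LIM_zero_cancel[OF tendsto_norm_zero_cancel])
  have int: "Bochner_Integration.simple_bochner_integrable (restrict_space M A) (s n)" for n
    using t by (simp add: simple_bochner_integrable_restrict_space[OF A'])
  have "(\<integral>\<^sup>+ x. ennreal (norm (f x - s n x)) \<partial>restrict_space M A)
      = (\<integral>\<^sup>+ x. ennreal (norm (?f x - ?t n x)) \<partial>M)" for n
    by (subst nn_integral_restrict_space[OF A']) (auto intro!: nn_integral_cong split: split_indicator)
  then have "(\<lambda>n. \<integral>\<^sup>+ x. ennreal (norm (f x - s n x)) \<partial>restrict_space M A) \<longlonglongrightarrow> 0"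
    using lim by simp
  moreover have "(\<lambda>n. Bochner_Integration.simple_bochner_integral (restrict_space M A) (s n)) \<longlonglongrightarrow> I"
    using tI by (simp add: simple_bochner_integral_restrict_space[OF A' int])
  moreover have "strongly_measurable (restrict_space M A) f"
  proof -
    obtain r where r: "\<And>n. simple_function M (r n)" "AE x in M. (\<lambda>n::nat. r n x) \<longlonglongrightarrow> ?f x"
      using I by (auto simp: has_strong_integral_def strongly_measurable_def)
    have "simple_function (restrict_space M A) (r n)" for n
      using r(1)[of n] A unfolding simple_function_restrict_space[OF A']
      by (intro simple_function_compose2[where h = scaleR] simple_function_indicator) auto
    moreover have "AE x in restrict_space M A. (\<lambda>n. r n x) \<longlonglongrightarrow> f x"
      using r(2) by (subst AE_restrict_space_iff[OF A']) (auto elim!: eventually_mono)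
    ultimately show ?thesis
      unfolding strongly_measurable_def by (intro exI[of _ "r"]) simp
  qed
  ultimately show ?thesis
    using int unfolding has_strong_integral_def by blast
qed

text \<open>This is how the increments of an indefinite integral are controlled: the two integrals
  differ by the integral of \<open>f\<close> over \<open>B - A\<close>.\<close>

lemma norm_strong_integral_restrict_diff_le:
  fixes f :: "'a \<Rightarrow> 'b::banach"
  assumes f: "strongly_measurable M f" and fin: "(\<integral>\<^sup>+ x. ennreal (norm (f x)) \<partial>M) < \<infinity>"
    and AB: "A \<in> sets M" "B \<in> sets M" "A \<subseteq> B"
  shows "ennreal (norm (strong_integral (restrict_space M B) f - strong_integral (restrict_space M A) f))
    \<le> (\<integral>\<^sup>+ x. ennreal (norm (f x)) * indicator (B - A) x \<partial>M)"
proof -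
  have ex: "\<exists>I. has_strong_integral M (\<lambda>x. indicator C x *\<^sub>R f x) I" if C: "C \<in> sets M" for C
  proof (rule has_strong_integral_exists[OF strongly_measurable_indicator_scaleR[OF f C]])
    have "(\<integral>\<^sup>+ x. ennreal (norm (indicator C x *\<^sub>R f x)) \<partial>M) \<le> (\<integral>\<^sup>+ x. ennreal (norm (f x)) \<partial>M)"
      by (intro nn_integral_mono ennreal_leI) (auto split: split_indicator)
    then show "(\<integral>\<^sup>+ x. ennreal (norm (indicator C x *\<^sub>R f x)) \<partial>M) < \<infinity>"
      using fin by (rule order_le_less_trans)
  qed
  obtain I where I: "has_strong_integral M (\<lambda>x. indicator A x *\<^sub>R f x) I"
    using ex[OF AB(1)] by (rule exE)
  obtain J where J: "has_strong_integral M (\<lambda>x. indicator B x *\<^sub>R f x) J"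
    using ex[OF AB(2)] by (rule exE)
  have "ennreal (norm (J - I))
      \<le> (\<integral>\<^sup>+ x. ennreal (norm (indicator B x *\<^sub>R f x - indicator A x *\<^sub>R f x)) \<partial>M)"
    by (rule norm_has_strong_integral_le[OF has_strong_integral_diff[OF J I]])
  also have "\<dots> = (\<integral>\<^sup>+ x. ennreal (norm (f x)) * indicator (B - A) x \<partial>M)"
    using AB(3) by (intro nn_integral_cong) (auto split: split_indicator)
  finally show ?thesis
    using strong_integral_eq[OF has_strong_integral_restrict_space[OF I AB(1)]]
      strong_integral_eq[OF has_strong_integral_restrict_space[OF J AB(2)]] by simp
qed


section \<open>Completeness of the Bochner spaces\<close>

lemma Lp_seminorm_nonneg: "0 \<le> Lp_seminorm M p f"
  by (simp add: Lp_seminorm_def)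

lemma nn_integral_powr_le_of_Lp_seminorm_le:
  assumes p: "0 < p" and f: "f \<in> Lp_fun M p" and C: "Lp_seminorm M p f \<le> C"
  shows "(\<integral>\<^sup>+ x. ennreal (norm (f x) powr p) \<partial>M) \<le> ennreal (C powr p)"
proof -
  let ?I = "\<integral>\<^sup>+ x. ennreal (norm (f x) powr p) \<partial>M"
  have "enn2real ?I = Lp_seminorm M p f powr p"
    using p by (simp add: Lp_seminorm_def powr_powr)
  also have "\<dots> \<le> C powr p"
    using p C by (intro powr_mono2) (auto simp: Lp_seminorm_nonneg)
  finally have "ennreal (enn2real ?I) \<le> ennreal (C powr p)"
    by (rule ennreal_leI)
  moreover have "ennreal (enn2real ?I) = ?I"
    using f by (intro ennreal_enn2real) (simp add: Lp_fun_def)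
  ultimately show ?thesis
    by simp
qed

lemma Lp_seminorm_leI:
  assumes p: "0 < p" and c: "0 \<le> c"
    and le: "(\<integral>\<^sup>+ x. ennreal (norm (f x) powr p) \<partial>M) \<le> ennreal (c powr p)"
  shows "Lp_seminorm M p f \<le> c"
proof -
  have "enn2real (\<integral>\<^sup>+ x. ennreal (norm (f x) powr p) \<partial>M) \<le> c powr p"
    using le by (intro enn2real_leI) auto
  then have "Lp_seminorm M p f \<le> (c powr p) powr (1 / p)"
    unfolding Lp_seminorm_def using p by (intro powr_mono2) auto
  also have "\<dots> = c"
    using p c by (simp add: powr_powr)
  finally show ?thesis .
qed

lemma Lp_fun_bounded_linear_image:
  assumes T: "bounded_linear T" and f: "f \<in> Lp_fun M p" and p: "0 < p"
  shows "(\<lambda>x. T (f x)) \<in> Lp_fun M p"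
proof -
  obtain K where K: "0 < K" "\<And>x. norm (T x) \<le> norm x * K"
    using bounded_linear.pos_bounded[OF T] by blast
  have fm: "strongly_measurable M f" and fin: "(\<integral>\<^sup>+ x. ennreal (norm (f x) powr p) \<partial>M) < \<infinity>"
    using f by (auto simp: Lp_fun_def)
  obtain h where h: "h \<in> borel_measurable M" "AE x in M. norm (f x) = h x"
    using strongly_measurable_norm[OF fm] by blast
  have ae: "AE x in M. norm (f x) = \<bar>h x\<bar>"
    using h(2) by eventually_elim (metis abs_norm_cancel)
  have "(\<integral>\<^sup>+ x. ennreal (\<bar>h x\<bar> powr p) \<partial>M) = (\<integral>\<^sup>+ x. ennreal (norm (f x) powr p) \<partial>M)"
    by (rule nn_integral_cong_AE) (use ae in \<open>auto elim!: eventually_mono\<close>)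
  then have "(\<integral>\<^sup>+ x. ennreal ((K * \<bar>h x\<bar>) powr p) \<partial>M) < \<infinity>"
    using nn_integral_powr_finite_cmult[OF h(1), of p K] fin K by simp
  moreover have "(\<integral>\<^sup>+ x. ennreal (norm (T (f x)) powr p) \<partial>M) \<le> (\<integral>\<^sup>+ x. ennreal ((K * \<bar>h x\<bar>) powr p) \<partial>M)"
    using ae
  proof (intro nn_integral_mono_AE, eventually_elim)
    fix x assume "norm (f x) = \<bar>h x\<bar>"
    then show "ennreal (norm (T (f x)) powr p) \<le> ennreal ((K * \<bar>h x\<bar>) powr p)"
      using K(2)[of "f x"] p by (intro ennreal_leI powr_mono2) (auto simp: mult.commute)
  qed
  ultimately have "(\<integral>\<^sup>+ x. ennreal (norm (T (f x)) powr p) \<partial>M) < \<infinity>"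
    by (rule order_le_less_trans[rotated])
  then show ?thesis
    using strongly_measurable_continuous_image[OF linear_continuous_on[OF T] fm]
    by (simp add: Lp_fun_def)
qed

lemma Lp_fun_simple_approx_dist:
  fixes f :: "'a \<Rightarrow> 'b::real_normed_vector"
  assumes p: "0 < p" and f: "f \<in> Lp_fun M p" and e: "0 < e"
  shows "\<exists>s. simple_function M s \<and> s \<in> Lp_fun M p \<and> Lp_seminorm M p (\<lambda>x. f x - s x) \<le> e"
proof -
  obtain s where s: "\<And>n::nat. simple_function M (s n)" "\<And>n. s n \<in> Lp_fun M p"
    and lim: "(\<lambda>n. \<integral>\<^sup>+ x. ennreal (norm (f x - s n x) powr p) \<partial>M) \<longlonglongrightarrow> 0"
    by (rule Lp_fun_simple_approx[OF p f], rule that)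
  have "eventually (\<lambda>n. (\<integral>\<^sup>+ x. ennreal (norm (f x - s n x) powr p) \<partial>M) < ennreal (e powr p)) sequentially"
    using e by (intro order_tendstoD(2)[OF lim]) simp
  then obtain n where "(\<integral>\<^sup>+ x. ennreal (norm (f x - s n x) powr p) \<partial>M) < ennreal (e powr p)"
    by (auto simp: eventually_sequentially)
  then have "Lp_seminorm M p (\<lambda>x. f x - s n x) \<le> e"
    using p e by (intro Lp_seminorm_leI) auto
  then show ?thesis
    using s[of n] by (intro exI[of _ "s n"]) simp
qed

lemma convergent_if_fast_Cauchy:
  fixes a :: "nat \<Rightarrow> 'b::banach"
  assumes "\<forall>\<^sub>F k in sequentially. norm (a (Suc k) - a k) \<le> (1/2) ^ k"
  shows "convergent a"
proof -
  have "summable (\<lambda>k. a (Suc k) - a k)"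
    by (rule summable_comparison_test_ev[OF assms]) (simp add: summable_geometric)
  then have "convergent (\<lambda>n. \<Sum>k<n. a (Suc k) - a k)"
    by (simp add: summable_iff_convergent)
  then have "convergent (\<lambda>n. a n - a 0)"
    by (simp only: sum_lessThan_telescope)
  then have "convergent (\<lambda>n. (a n - a 0) + a 0)"
    by (rule convergent_add[OF _ convergent_const])
  then show ?thesis
    by simp
qed

text \<open>The function \<open>\<Sum>k. (2 ^ k * norm (s (Suc k) x - s k x)) powr p\<close> has integral at most
  \<open>\<Sum>k. (1/2) ^ k\<close>, so it is finite almost everywhere. Where it is finite its terms are
  eventually below one, and the increments are dominated by a geometric series.\<close>

lemma AE_convergent_of_summable_Lp_differences:
  fixes s :: "nat \<Rightarrow> 'a \<Rightarrow> 'b::banach"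
  assumes p: "1 \<le> p"
    and meas: "\<And>k. (\<lambda>x. norm (s (Suc k) x - s k x)) \<in> borel_measurable M"
    and le: "\<And>k. (\<integral>\<^sup>+ x. ennreal (norm (s (Suc k) x - s k x) powr p) \<partial>M) \<le> ennreal (((1/4) ^ k) powr p)"
  shows "AE x in M. convergent (\<lambda>k. s k x)"
proof -
  note [measurable] = meas
  let ?d = "\<lambda>k x. norm (s (Suc k) x - s k x)"
  let ?w = "\<lambda>k x. ennreal ((2 ^ k * ?d k x) powr p)"
  have int: "(\<integral>\<^sup>+ x. ?w k x \<partial>M) \<le> ennreal ((1/2) ^ k)" for k
  proof -
    have "(\<integral>\<^sup>+ x. ?w k x \<partial>M) = (\<integral>\<^sup>+ x. ennreal ((2 ^ k) powr p) * ennreal (?d k x powr p) \<partial>M)"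
      by (intro nn_integral_cong) (simp add: powr_mult ennreal_mult)
    also have "\<dots> = ennreal ((2 ^ k) powr p) * (\<integral>\<^sup>+ x. ennreal (?d k x powr p) \<partial>M)"
      by (intro nn_integral_cmult) auto
    also have "\<dots> \<le> ennreal ((2 ^ k) powr p) * ennreal (((1/4) ^ k) powr p)"
      by (intro mult_left_mono le) auto
    also have "\<dots> = ennreal ((2 ^ k * (1/4) ^ k) powr p)"
      by (simp add: powr_mult flip: ennreal_mult)
    also have "2 ^ k * (1/4) ^ k = ((1/2) ^ k :: real)"
      by (simp flip: power_mult_distrib)
    also have "ennreal (((1/2) ^ k) powr p) \<le> ennreal (((1/2) ^ k) powr 1)"
      using p by (intro ennreal_leI powr_mono') (auto simp: power_le_one)
    finally show ?thesis
      by simp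
  qed
  have "(\<integral>\<^sup>+ x. (\<Sum>k. ?w k x) \<partial>M) = (\<Sum>k. \<integral>\<^sup>+ x. ?w k x \<partial>M)"
    by (intro nn_integral_suminf) auto
  also have "\<dots> \<le> (\<Sum>k. ennreal ((1/2) ^ k))"
    by (intro suminf_le int) auto
  also have "\<dots> = ennreal (\<Sum>k. (1/2) ^ k)"
    by (intro suminf_ennreal2) (auto simp: summable_geometric)
  also have "\<dots> < \<infinity>"
    by simp
  finally have "(\<integral>\<^sup>+ x. (\<Sum>k. ?w k x) \<partial>M) \<noteq> \<infinity>"
    by simp
  then have "AE x in M. (\<Sum>k. ?w k x) \<noteq> \<infinity>"
    by (intro nn_integral_PInf_AE) auto
  then show ?thesis
  proof eventually_elim
    fix x assume "(\<Sum>k. ?w k x) \<noteq> \<infinity>"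
    then have "summable (\<lambda>k. (2 ^ k * ?d k x) powr p)"
      by (intro summable_suminf_not_top) auto
    then have "(\<lambda>k. (2 ^ k * ?d k x) powr p) \<longlonglongrightarrow> 0"
      by (rule summable_LIMSEQ_zero)
    then have "\<forall>\<^sub>F k in sequentially. (2 ^ k * ?d k x) powr p < 1"
      by (rule order_tendstoD) simp
    then have "\<forall>\<^sub>F k in sequentially. ?d k x \<le> (1/2) ^ k"
    proof eventually_elim
      fix k assume *: "(2 ^ k * ?d k x) powr p < 1"
      have "2 ^ k * ?d k x \<le> 1"
      proof (rule ccontr)
        assume "\<not> 2 ^ k * ?d k x \<le> 1"
        then have "1 \<le> (2 ^ k * ?d k x) powr p"
          using p by (intro ge_one_powr_ge_zero) auto
        with * show False by simp
      qed
      then show "?d k x \<le> (1/2) ^ k"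
        by (simp add: power_one_over field_simps)
    qed
    then show "convergent (\<lambda>k. s k x)"
      by (rule convergent_if_fast_Cauchy)
  qed
qed

text \<open>The Riesz--Fischer theorem. The Cauchy sequence is first replaced by simple functions at
  distance tending to zero. An almost everywhere limit of a fast subsequence of these is then
  strongly measurable by definition. Fatou's lemma shows that the limit is also one in \<open>L\<^sup>p\<close>.\<close>

lemma mcomplete_Lp:
  fixes M :: "'a measure"
  assumes p: "1 \<le> p"
  shows "Metric_space.mcomplete (Lp_space M p :: ('a \<Rightarrow> 'b::banach) set set) (Lp_dist M p)"
proof -
  interpret Metric_space "Lp_space M p :: ('a \<Rightarrow> 'b) set set" "Lp_dist M p"
    by (rule Metric_space_Lp[OF p])
  have p0: "0 < p"
    using p by simp
  show ?thesis
    unfolding mcomplete_def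
  proof (intro allI impI)
    fix \<sigma> :: "nat \<Rightarrow> ('a \<Rightarrow> 'b) set"
    assume \<sigma>: "MCauchy \<sigma>"
    have in_space: "\<sigma> n \<in> Lp_space M p" for n
      using \<sigma> by (auto simp: MCauchy_def)
    have "\<exists>s. simple_function M s \<and> s \<in> Lp_fun M p
        \<and> Lp_seminorm M p (\<lambda>x. Lp_rep (\<sigma> n) x - s x) \<le> 1 / Suc n" for n
      by (rule Lp_fun_simple_approx_dist[OF p0 Lp_rep_fun[OF in_space]]) simp
    then obtain s where s: "\<And>n. simple_function M (s n)" "\<And>n. s n \<in> Lp_fun M p"
      and s_dist: "\<And>n. Lp_seminorm M p (\<lambda>x. Lp_rep (\<sigma> n) x - s n x) \<le> 1 / Suc n"
      by metis
    define S where "S n = Lp_class M p (s n)" for n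
    have S: "S n \<in> Lp_space M p" and sS: "s n \<in> S n" for n
      using s(2) by (auto simp: S_def intro: Lp_class_in_Lp_space Lp_class_mem)
    have dS: "Lp_dist M p (S m) (S n) = Lp_seminorm M p (\<lambda>x. s m x - s n x)" for m n
      by (rule Lp_dist_eq[OF S S sS sS])
    have \<sigma>S: "Lp_dist M p (\<sigma> n) (S n) \<le> 1 / Suc n" for n
      using s_dist[of n] Lp_dist_eq[OF in_space S Lp_rep_mem[OF in_space] sS] by simp
    have inv0: "(\<lambda>n. 1 / real (Suc n)) \<longlonglongrightarrow> 0"
      using LIMSEQ_inverse_real_of_nat by (simp add: inverse_eq_divide)
    have S_Cauchy: "\<exists>N. \<forall>m\<ge>N. \<forall>n\<ge>N. Lp_dist M p (S m) (S n) < e" if e: "0 < e" for e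
    proof -
      obtain N1 where N1: "\<And>m n. N1 \<le> m \<Longrightarrow> N1 \<le> n \<Longrightarrow> Lp_dist M p (\<sigma> m) (\<sigma> n) < e / 3"
        using \<sigma> e unfolding MCauchy_def by (metis divide_pos_pos zero_less_numeral)
      obtain N2 where N2: "\<And>n. N2 \<le> n \<Longrightarrow> 1 / real (Suc n) < e / 3"
        using order_tendstoD(2)[OF inv0, of "e / 3"] e by (auto simp: eventually_sequentially)
      show ?thesis
      proof (intro exI[of _ "max N1 N2"] allI impI)
        fix m n assume "max N1 N2 \<le> m" "max N1 N2 \<le> n"
        then have "Lp_dist M p (\<sigma> m) (\<sigma> n) < e / 3" "Lp_dist M p (\<sigma> m) (S m) < e / 3"
            "Lp_dist M p (\<sigma> n) (S n) < e / 3"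
          using N1[of m n] N2[of m] N2[of n] \<sigma>S[of m] \<sigma>S[of n] by auto
        moreover have "Lp_dist M p (S m) (S n)
            \<le> Lp_dist M p (S m) (\<sigma> m) + Lp_dist M p (\<sigma> m) (S n)"
          by (rule triangle[OF S in_space S])
        moreover have "Lp_dist M p (\<sigma> m) (S n) \<le> Lp_dist M p (\<sigma> m) (\<sigma> n) + Lp_dist M p (\<sigma> n) (S n)"
          by (rule triangle[OF in_space in_space S])
        moreover have "Lp_dist M p (S m) (\<sigma> m) = Lp_dist M p (\<sigma> m) (S m)"
          by (rule commute)
        ultimately show "Lp_dist M p (S m) (S n) < e"
          by linarith
      qed
    qed
    have "\<exists>N. \<forall>m\<ge>N. \<forall>n\<ge>N. Lp_dist M p (S m) (S n) < (1/4) ^ k" for k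
      by (rule S_Cauchy) simp
    then obtain N where N: "\<And>k m n. N k \<le> m \<Longrightarrow> N k \<le> n \<Longrightarrow> Lp_dist M p (S m) (S n) < (1/4) ^ k"
      by metis
    \<comment> \<open>The first summand makes \<open>r\<close> strictly increasing, the second one makes it dominate \<open>N\<close>.\<close>
    define r where "r k = k + (\<Sum>i\<le>k. N i)" for k
    have r: "strict_mono r"
      by (simp add: strict_mono_Suc_iff r_def)
    have rN: "N k \<le> r k" for k
      unfolding r_def using member_le_sum[of k "{..k}" N] by simp
    have diff_le: "(\<integral>\<^sup>+ x. ennreal (norm (s m x - s n x) powr p) \<partial>M) \<le> ennreal (e powr p)"
      if "Lp_dist M p (S m) (S n) < e" for m n e
      by (rule nn_integral_powr_le_of_Lp_seminorm_le[OF p0 Lp_fun_diff[OF p s(2) s(2)]])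
         (use that dS in simp)
    have meas: "(\<lambda>x. norm (s m x - s n x)) \<in> borel_measurable M" for m n
      using s(1) by (intro borel_measurable_simple_function
          simple_function_compose2[where h = "\<lambda>x y. norm (x - y)"])
    have conv: "AE x in M. convergent (\<lambda>k. s (r k) x)"
    proof (rule AE_convergent_of_summable_Lp_differences[OF p meas])
      fix k
      have "N k \<le> r (Suc k)"
        using rN[of k] strict_monoD[OF r, of k "Suc k"] by simp
      then show "(\<integral>\<^sup>+ x. ennreal (norm (s (r (Suc k)) x - s (r k) x) powr p) \<partial>M) \<le> ennreal (((1/4) ^ k) powr p)"
        using rN[of k] by (intro diff_le N)
    qed
    define f where "f x = lim (\<lambda>k. s (r k) x)" for x
    have lim: "AE x in M. (\<lambda>k. s (r k) x) \<longlonglongrightarrow> f x"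
      using conv by eventually_elim (simp add: f_def convergent_LIMSEQ_iff)
    have fm: "strongly_measurable M f"
      unfolding strongly_measurable_def using s(1) lim
      by (intro exI[of _ "\<lambda>k. s (r k)"]) simp
    have Fatou: "(\<integral>\<^sup>+ x. ennreal (norm (s n x - f x) powr p) \<partial>M) \<le> ennreal (e powr p)"
      if K: "\<And>m. K \<le> m \<Longrightarrow> Lp_dist M p (S m) (S n) < e" for n K e
    proof -
      have "(\<integral>\<^sup>+ x. ennreal (norm (s n x - f x) powr p) \<partial>M)
          = (\<integral>\<^sup>+ x. liminf (\<lambda>k. ennreal (norm (s (r k) x - s n x) powr p)) \<partial>M)"
      proof (rule nn_integral_cong_AE, use lim in eventually_elim)
        fix x assume "(\<lambda>k. s (r k) x) \<longlonglongrightarrow> f x"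
        then have "(\<lambda>k. norm (s (r k) x - s n x)) \<longlonglongrightarrow> norm (f x - s n x)"
          by (intro tendsto_intros)
        then have "(\<lambda>k. norm (s (r k) x - s n x) powr p) \<longlonglongrightarrow> norm (f x - s n x) powr p"
          using p0 by (intro tendsto_powr') auto
        then have "liminf (\<lambda>k. ennreal (norm (s (r k) x - s n x) powr p)) = ennreal (norm (f x - s n x) powr p)"
          by (intro lim_imp_Liminf tendsto_ennrealI) auto
        then show "ennreal (norm (s n x - f x) powr p)
            = liminf (\<lambda>k. ennreal (norm (s (r k) x - s n x) powr p))"
          by (simp add: norm_minus_commute)
      qed
      also have "\<dots> \<le> liminf (\<lambda>k. \<integral>\<^sup>+ x. ennreal (norm (s (r k) x - s n x) powr p) \<partial>M)"
        using meas by (intro nn_integral_liminf) auto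
      also have "\<dots> \<le> limsup (\<lambda>k. \<integral>\<^sup>+ x. ennreal (norm (s (r k) x - s n x) powr p) \<partial>M)"
        by (intro Liminf_le_Limsup) simp
      also have "\<dots> \<le> ennreal (e powr p)"
      proof (rule Limsup_bounded)
        show "\<forall>\<^sub>F k in sequentially. (\<integral>\<^sup>+ x. ennreal (norm (s (r k) x - s n x) powr p) \<partial>M) \<le> ennreal (e powr p)"
          using eventually_ge_at_top[of K]
        proof eventually_elim
          fix k assume "K \<le> k"
          then have "K \<le> r k"
            using seq_suble[OF r, of k] by simp
          then show "(\<integral>\<^sup>+ x. ennreal (norm (s (r k) x - s n x) powr p) \<partial>M) \<le> ennreal (e powr p)"
            by (intro diff_le K)
        qed
      qed
      finally show ?thesis .
    qed
    have f: "f \<in> Lp_fun M p"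
    proof -
      let ?n = "N 0"
      have "(\<integral>\<^sup>+ x. ennreal (norm (s ?n x - f x) powr p) \<partial>M) \<le> ennreal (((1/4) ^ 0) powr p)"
        by (rule Fatou[of "N 0"], rule N) auto
      also have "\<dots> < \<infinity>"
        by simp
      finally have "(\<lambda>x. s ?n x - f x) \<in> Lp_fun M p"
        using strongly_measurable_diff[OF simple_function_strongly_measurable[OF s(1)] fm]
        by (simp add: Lp_fun_def)
      from Lp_fun_diff[OF p s(2)[of ?n] this] show ?thesis
        by simp
    qed
    let ?F = "Lp_class M p f"
    have F: "?F \<in> Lp_space M p" "f \<in> ?F"
      using f by (auto intro: Lp_class_in_Lp_space Lp_class_mem)
    have "(\<lambda>n. Lp_dist M p (S n) ?F) \<longlonglongrightarrow> 0"
    proof (rule LIMSEQ_I)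
      fix e :: real assume e: "0 < e"
      then obtain K where K: "\<And>m n. K \<le> m \<Longrightarrow> K \<le> n \<Longrightarrow> Lp_dist M p (S m) (S n) < e / 2"
        using S_Cauchy[of "e / 2"] by auto
      show "\<exists>no. \<forall>n\<ge>no. norm (Lp_dist M p (S n) ?F - 0) < e"
      proof (intro exI[of _ K] allI impI)
        fix n assume n: "K \<le> n"
        have "Lp_dist M p (S n) ?F = Lp_seminorm M p (\<lambda>x. s n x - f x)"
          by (rule Lp_dist_eq[OF S F(1) sS F(2)])
        also have "\<dots> \<le> e / 2"
          using e p0 n by (intro Lp_seminorm_leI Fatou[of K] K) auto
        finally show "norm (Lp_dist M p (S n) ?F - 0) < e"
          using e nonneg[of "S n" ?F] by simp
      qed
    qed
    then have lim0: "(\<lambda>n. 1 / real (Suc n) + Lp_dist M p (S n) ?F) \<longlonglongrightarrow> 0"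
      using tendsto_add[OF inv0] by fastforce
    have "(\<lambda>n. Lp_dist M p (\<sigma> n) ?F) \<longlonglongrightarrow> 0"
    proof (rule tendsto_sandwich[OF _ _ tendsto_const lim0])
      have "Lp_dist M p (\<sigma> n) ?F \<le> 1 / real (Suc n) + Lp_dist M p (S n) ?F" for n
        using triangle[OF in_space[of n] S[of n] F(1)] \<sigma>S[of n] by linarith
      then show "\<forall>\<^sub>F n in sequentially. Lp_dist M p (\<sigma> n) ?F \<le> 1 / real (Suc n) + Lp_dist M p (S n) ?F"
        by simp
    qed simp
    then show "\<exists>F. limitin mtopology \<sigma> F sequentially"
      using F(1) in_space by (intro exI[of _ ?F]) (simp add: limitin_metric_dist_null)
  qed
qed


section \<open>Compact embeddings\<close>

lemma compact_operator_compose: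
  assumes T: "compact_operator T" and J: "bounded_linear J"
  shows "compact_operator (J \<circ> T)"
  unfolding compact_operator_def
proof (intro conjI allI impI)
  show "bounded_linear (J \<circ> T)"
    using T bounded_linear_compose[OF J, of T] by (simp add: compact_operator_def o_def)
  fix S :: "'a set" assume "bounded S"
  then have "compact (closure (T ` S))"
    using T by (simp add: compact_operator_def)
  then have K: "compact (J ` closure (T ` S))"
    by (intro compact_continuous_image linear_continuous_on J)
  have "(J \<circ> T) ` S \<subseteq> J ` closure (T ` S)"
    using closure_subset[of "T ` S"] by auto
  then have "closure ((J \<circ> T) ` S) \<subseteq> J ` closure (T ` S)"
    by (intro closure_minimal compact_imp_closed K)
  then show "compact (closure ((J \<circ> T) ` S))"
    using compact_Int_closed[OF K closed_closure, of "(J \<circ> T) ` S"] by (simp add: inf.absorb2)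
qed

lemma compact_operator_finite_net:
  fixes T :: "'a::real_normed_vector \<Rightarrow> 'b::real_normed_vector"
  assumes T: "compact_operator T" and e: "0 < e"
  shows "\<exists>Y. finite Y \<and> (\<forall>v. norm v \<le> R \<longrightarrow> (\<exists>y\<in>Y. norm (T v - y) < e))"
proof -
  have "compact (closure (T ` cball 0 R))"
    using T by (simp add: compact_operator_def)
  then obtain Y where Y: "finite Y" "closure (T ` cball 0 R) \<subseteq> (\<Union>y\<in>Y. ball y e)"
    using e compact_eq_totally_bounded by metis
  show ?thesis
  proof (intro exI conjI allI impI)
    fix v :: 'a assume "norm v \<le> R"
    then have "T v \<in> closure (T ` cball 0 R)"
      using closure_subset[of "T ` cball 0 R"] by (auto simp: dist_norm)
    then obtain y where "y \<in> Y" "T v \<in> ball y e"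
      using Y(2) by blast
    then show "\<exists>y\<in>Y. norm (T v - y) < e"
      by (auto simp: dist_norm norm_minus_commute)
  qed (rule Y)
qed

text \<open>Otherwise there are unit vectors \<open>y n\<close> with \<open>norm (T (y n)) > e\<close> and \<open>J (T (y n))\<close> tending to
  zero. By compactness \<open>T (y n)\<close> has a limit point \<open>l\<close>; it satisfies \<open>norm l \<ge> e\<close> but \<open>J l = 0\<close>,
  against injectivity.\<close>

lemma Ehrling:
  fixes T :: "'a::real_normed_vector \<Rightarrow> 'b::real_normed_vector"
    and J :: "'b \<Rightarrow> 'c::real_normed_vector"
  assumes T: "compact_operator T" and J: "bounded_linear J" "inj J" and e: "0 < e"
  shows "\<exists>C\<ge>0. \<forall>x. norm (T x) \<le> e * norm x + C * norm (J (T x))"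
proof (rule ccontr)
  assume contra: "\<not> ?thesis"
  have linT: "bounded_linear T"
    using T by (simp add: compact_operator_def)
  interpret T: bounded_linear T by (rule linT)
  interpret J: bounded_linear J by (rule J(1))
  have "\<exists>x. e * norm x + real (Suc n) * norm (J (T x)) < norm (T x)" for n
    using contra by (metis linorder_not_le of_nat_0_le_iff)
  then obtain x where x: "\<And>n. e * norm (x n) + real (Suc n) * norm (J (T (x n))) < norm (T (x n))"
    by metis
  have x_nz: "0 < norm (x n)" for n
  proof (rule ccontr)
    assume "\<not> 0 < norm (x n)"
    then have "x n = 0" by simp
    then show False using x[of n] by (simp add: T.zero J.zero)
  qed
  define y where "y n = x n /\<^sub>R norm (x n)" for n
  have y_norm: "norm (y n) = 1" for n
    using x_nz[of n] by (simp add: y_def)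
  have y: "e + real (Suc n) * norm (J (T (y n))) < norm (T (y n))" for n
  proof -
    have "norm (T (y n)) = norm (T (x n)) / norm (x n)"
        "norm (J (T (y n))) = norm (J (T (x n))) / norm (x n)"
      by (simp_all add: y_def T.scaleR J.scaleR divide_inverse mult.commute)
    then show ?thesis
      using divide_strict_right_mono[OF x[of n] x_nz[of n]] x_nz[of n] by (simp add: add_divide_distrib)
  qed
  have "compact (closure (T ` cball 0 1))"
    using T by (simp add: compact_operator_def)
  moreover have "T (y n) \<in> closure (T ` cball 0 1)" for n
    using closure_subset[of "T ` cball 0 1"] y_norm[of n] by (auto simp: dist_norm)
  ultimately obtain l r where r: "strict_mono (r :: nat \<Rightarrow> nat)"
    and l: "((\<lambda>n. T (y n)) \<circ> r) \<longlonglongrightarrow> l"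
    using seq_compactE[OF compact_imp_seq_compact, of "closure (T ` cball 0 1)" "\<lambda>n. T (y n)"] by metis
  have l': "(\<lambda>n. T (y (r n))) \<longlonglongrightarrow> l"
    using l by (simp add: o_def)
  obtain B where B: "\<And>x. norm (T x) \<le> norm x * B"
    using T.bounded by blast
  have small: "norm (J (T (y (r n)))) \<le> B / real (Suc n)" for n
  proof -
    have "real (Suc n) * norm (J (T (y (r n)))) \<le> real (Suc (r n)) * norm (J (T (y (r n))))"
      using seq_suble[OF r, of n] by (intro mult_right_mono) auto
    also have "\<dots> \<le> norm (T (y (r n)))"
      using y[of "r n"] e by linarith
    also have "\<dots> \<le> B"
      using B[of "y (r n)"] y_norm by simp
    finally show ?thesis
      by (simp add: pos_le_divide_eq mult.commute)
  qed
  have "(\<lambda>n. J (T (y (r n)))) \<longlonglongrightarrow> 0"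
  proof (rule Lim_null_comparison)
    show "(\<lambda>n. B / real (Suc n)) \<longlonglongrightarrow> 0"
      by (rule LIMSEQ_Suc[OF lim_const_over_n])
  qed (use small in simp)
  moreover have "(\<lambda>n. J (T (y (r n)))) \<longlonglongrightarrow> J l"
    by (rule J.tendsto[OF l'])
  ultimately have "J l = J 0"
    using LIMSEQ_unique J.zero by metis
  then have "l = 0"
    by (rule injD[OF J(2)])
  have "e \<le> norm (T (y (r n)))" for n
  proof -
    have "0 \<le> real (Suc (r n)) * norm (J (T (y (r n))))"
      by simp
    then show ?thesis
      using y[of "r n"] by linarith
  qed
  then have "e \<le> norm l"
    by (intro LIMSEQ_le_const[OF tendsto_norm[OF l']]) blast
  with \<open>l = 0\<close> e show False
    by simp
qed

section \<open>Bounded sets in Bochner spaces\<close>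

lemma real_le_powr_truncation:
  fixes y l p :: real
  assumes "0 \<le> y" "0 < l" "1 \<le> p"
  shows "y \<le> l powr (1 - p) * y powr p + l"
proof (cases "y \<le> l")
  case True
  then show ?thesis
    by (simp add: add_increasing)
next
  case False
  then have "y powr (1 - p) \<le> l powr (1 - p)"
    using assms by (intro powr_mono2') auto
  then have "y powr (1 - p) * y powr p \<le> l powr (1 - p) * y powr p"
    by (intro mult_right_mono) auto
  moreover have "y powr (1 - p) * y powr p = y"
    using False assms by (simp flip: powr_add)
  ultimately show ?thesis
    using assms by linarith
qed

text \<open>For \<open>p > 1\<close> the first term is small for large \<open>l\<close>, whatever \<open>A\<close> is, and then the second is
  small for small \<open>A\<close>. So bounded sets of \<open>L\<^sup>p\<close> are uniformly integrable.\<close>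

lemma Lp_uniformly_integrable:
  fixes f :: "'a \<Rightarrow> 'b::real_normed_vector"
  assumes p: "1 \<le> p" and f: "f \<in> Lp_fun M p" "Lp_seminorm M p f \<le> K"
    and A: "A \<in> sets M" and l: "0 < l"
  shows "(\<integral>\<^sup>+ x. ennreal (norm (f x)) * indicator A x \<partial>M)
    \<le> ennreal (l powr (1 - p) * K powr p) + ennreal l * emeasure M A"
proof -
  obtain h where [measurable]: "h \<in> borel_measurable M" and h: "AE x in M. norm (f x) = h x"
    using f(1) strongly_measurable_norm[of M f] by (auto simp: Lp_fun_def)
  note A[measurable]
  have "(\<integral>\<^sup>+ x. ennreal (norm (f x)) * indicator A x \<partial>M)
      \<le> (\<integral>\<^sup>+ x. ennreal (l powr (1 - p)) * ennreal (h x powr p) + ennreal l * indicator A x \<partial>M)"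
    using h
  proof (intro nn_integral_mono_AE, eventually_elim)
    fix x assume hx: "norm (f x) = h x"
    have "norm (f x) \<le> l powr (1 - p) * norm (f x) powr p + l"
      using p l by (intro real_le_powr_truncation) auto
    then have "ennreal (norm (f x)) \<le> ennreal (l powr (1 - p)) * ennreal (norm (f x) powr p) + ennreal l"
      using l by (simp add: ennreal_leI flip: ennreal_mult ennreal_plus)
    then show "ennreal (norm (f x)) * indicator A x
        \<le> ennreal (l powr (1 - p)) * ennreal (h x powr p) + ennreal l * indicator A x"
      by (simp add: hx split: split_indicator)
  qed
  also have "\<dots> = ennreal (l powr (1 - p)) * (\<integral>\<^sup>+ x. ennreal (h x powr p) \<partial>M) + ennreal l * emeasure M A"
    by (simp add: nn_integral_add nn_integral_cmult)
  also have "(\<integral>\<^sup>+ x. ennreal (h x powr p) \<partial>M) = (\<integral>\<^sup>+ x. ennreal (norm (f x) powr p) \<partial>M)"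
    by (rule nn_integral_cong_AE) (use h in \<open>auto elim!: eventually_mono\<close>)
  also have "ennreal (l powr (1 - p)) * (\<integral>\<^sup>+ x. ennreal (norm (f x) powr p) \<partial>M)
      \<le> ennreal (l powr (1 - p)) * ennreal (K powr p)"
    using p f by (intro mult_left_mono nn_integral_powr_le_of_Lp_seminorm_le) auto
  finally show ?thesis
    by (simp add: ennreal_mult add_right_mono)
qed

text \<open>If \<open>norm (f x)\<close> exceeded this bound almost everywhere on \<open>A\<close>, then the integral of
  \<open>norm (f x) powr p\<close> over \<open>A\<close> would be at least \<open>K powr p + 1\<close>.\<close>

lemma Lp_exists_bounded_value:
  fixes f :: "'a \<Rightarrow> 'b::real_normed_vector"
  assumes p: "0 < p" and f: "f \<in> Lp_fun M p" "Lp_seminorm M p f \<le> K"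
    and A: "A \<in> sets M" "0 < measure M A" and P: "AE x in M. P x"
  shows "\<exists>x\<in>A. P x \<and> norm (f x) \<le> ((K powr p + 1) / measure M A) powr (1 / p)"
proof (rule ccontr)
  let ?m = "measure M A"
  let ?R = "((K powr p + 1) / ?m) powr (1 / p)"
  assume "\<not> (\<exists>x\<in>A. P x \<and> norm (f x) \<le> ?R)"
  then have big: "?R \<le> norm (f x)" if "x \<in> A" "P x" for x
    using that by force
  have Rp: "?R powr p = (K powr p + 1) / ?m"
    using p A(2) by (simp add: powr_powr)
  have "ennreal (K powr p + 1) = ennreal (?R powr p) * emeasure M A"
  proof -
    have "emeasure M A = ennreal ?m"
      using A(2) by (intro emeasure_eq_ennreal_measure) (auto simp: measure_def)
    then show ?thesis
      using A(2) by (simp add: Rp flip: ennreal_mult)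
  qed
  also have "\<dots> = (\<integral>\<^sup>+ x. ennreal (?R powr p) * indicator A x \<partial>M)"
    using A(1) by (simp add: nn_integral_cmult)
  also have "\<dots> \<le> (\<integral>\<^sup>+ x. ennreal (norm (f x) powr p) \<partial>M)"
    using P
  proof (intro nn_integral_mono_AE, eventually_elim)
    fix x assume "P x"
    then show "ennreal (?R powr p) * indicator A x \<le> ennreal (norm (f x) powr p)"
      using big[of x] p by (auto split: split_indicator intro!: ennreal_leI powr_mono2)
  qed
  also have "\<dots> \<le> ennreal (K powr p)"
    by (rule nn_integral_powr_le_of_Lp_seminorm_le[OF p f])
  finally show False
    by (simp add: ennreal_le_iff)
qed

lemma half_powr_add_half_powr_le:
  fixes e p :: real
  assumes "0 \<le> e" "1 \<le> p"
  shows "(e / 2) powr p + (e / 2) powr p \<le> e powr p"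
proof -
  have "(e / 2) powr p = (1 / 2) powr p * e powr p"
    using assms powr_mult[of "1 / 2" e p] by simp
  moreover have "(1 / 2) powr p \<le> (1 / 2) powr (1 :: real)"
    using assms by (intro powr_mono') auto
  then have "(1 / 2) powr p * e powr p \<le> 1 / 2 * e powr p"
    by (intro mult_right_mono) auto
  ultimately show ?thesis
    by linarith
qed

text \<open>Turns Ehrling's inequality into one between \<open>L\<^sup>p\<close> seminorms on a space of mass \<open>m\<close>. The
  term \<open>e * norm (f x)\<close> and the constant \<open>c\<close> each contribute at most \<open>(\<epsilon> / 2) powr p\<close>.\<close>

lemma Lp_seminorm_le_of_norm_le_affine:
  fixes f :: "'a \<Rightarrow> 'b::real_normed_vector" and k :: "'a \<Rightarrow> 'c::real_normed_vector"
  assumes p: "1 \<le> p" and M: "emeasure M (space M) = ennreal m" "0 \<le> m"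
    and f: "f \<in> Lp_fun M p" "Lp_seminorm M p f \<le> K"
    and le: "AE x in M. norm (k x) \<le> e * norm (f x) + c"
    and e: "0 \<le> e" "2 * e * K \<le> \<epsilon> / 2" and c: "0 \<le> c" "2 * c * (m + 1) \<le> \<epsilon> / 2"
  shows "Lp_seminorm M p k \<le> \<epsilon>"
proof (rule Lp_seminorm_leI)
  show "0 < p"
    using p by simp
  have K: "0 \<le> K"
    using f(2) Lp_seminorm_nonneg[of M p f] by linarith
  have "0 \<le> 2 * c * (m + 1)"
    using c M by simp
  then show \<epsilon>: "0 \<le> \<epsilon>"
    using c by linarith
  obtain h where [measurable]: "h \<in> borel_measurable M" and h: "AE x in M. norm (f x) = h x"
    using f(1) strongly_measurable_norm[of M f] by (auto simp: Lp_fun_def)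
  have "(\<integral>\<^sup>+ x. ennreal (norm (k x) powr p) \<partial>M)
      \<le> (\<integral>\<^sup>+ x. ennreal ((2 * e) powr p) * ennreal (h x powr p) + ennreal ((2 * c) powr p) \<partial>M)"
    using h le
  proof (intro nn_integral_mono_AE, eventually_elim)
    fix x assume hx: "norm (f x) = h x" and kx: "norm (k x) \<le> e * norm (f x) + c"
    let ?y = "norm (f x)"
    have "norm (k x) powr p \<le> (e * ?y + c) powr p"
      using kx p by (intro powr_mono2) auto
    also have "\<dots> \<le> (max (2 * e * ?y) (2 * c)) powr p"
      using e c p by (intro powr_mono2) auto
    also have "\<dots> \<le> (2 * e * ?y) powr p + (2 * c) powr p"
      by (auto simp: max_def)
    also have "(2 * e * ?y) powr p = (2 * e) powr p * ?y powr p"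
      using e by (simp add: powr_mult)
    finally show "ennreal (norm (k x) powr p)
        \<le> ennreal ((2 * e) powr p) * ennreal (h x powr p) + ennreal ((2 * c) powr p)"
      by (simp add: hx ennreal_leI flip: ennreal_mult ennreal_plus)
  qed
  also have "\<dots> = ennreal ((2 * e) powr p) * (\<integral>\<^sup>+ x. ennreal (h x powr p) \<partial>M)
      + ennreal ((2 * c) powr p) * ennreal m"
    by (simp add: nn_integral_add nn_integral_cmult M)
  also have "(\<integral>\<^sup>+ x. ennreal (h x powr p) \<partial>M) = (\<integral>\<^sup>+ x. ennreal (norm (f x) powr p) \<partial>M)"
    by (rule nn_integral_cong_AE) (use h in \<open>auto elim!: eventually_mono\<close>)
  also have "ennreal ((2 * e) powr p) * (\<integral>\<^sup>+ x. ennreal (norm (f x) powr p) \<partial>M)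
      \<le> ennreal ((2 * e) powr p) * ennreal (K powr p)"
    using p f by (intro mult_left_mono nn_integral_powr_le_of_Lp_seminorm_le) auto
  also have "ennreal ((2 * e) powr p) * ennreal (K powr p) + ennreal ((2 * c) powr p) * ennreal m
      = ennreal ((2 * e * K) powr p + (2 * c) powr p * m)"
    using e K M by (simp add: powr_mult flip: ennreal_mult ennreal_plus)
  also have "\<dots> \<le> ennreal (\<epsilon> powr p)"
  proof (rule ennreal_leI)
    have "(2 * e * K) powr p \<le> (\<epsilon> / 2) powr p"
      using e K p by (intro powr_mono2) auto
    moreover have "(2 * c) powr p * m \<le> (\<epsilon> / 2) powr p"
    proof -
      have "m \<le> (m + 1) powr 1"
        using M by simp
      also have "\<dots> \<le> (m + 1) powr p"
        using M p by (intro powr_mono) auto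
      finally have "(2 * c) powr p * m \<le> (2 * c) powr p * (m + 1) powr p"
        by (intro mult_left_mono) auto
      also have "\<dots> = (2 * c * (m + 1)) powr p"
        using c M by (simp add: powr_mult)
      also have "\<dots> \<le> (\<epsilon> / 2) powr p"
        using c M p by (intro powr_mono2) auto
      finally show ?thesis .
    qed
    ultimately show "(2 * e * K) powr p + (2 * c) powr p * m \<le> \<epsilon> powr p"
      using half_powr_add_half_powr_le[OF \<epsilon> p] by linarith
  qed
  finally show "(\<integral>\<^sup>+ x. ennreal (norm (k x) powr p) \<partial>M) \<le> ennreal (\<epsilon> powr p)"
    by (auto intro: order_trans add_right_mono)
qed

section \<open>Step approximation of evolution states\<close>

lemma restrict_LS_on:
  "t \<le> b \<Longrightarrow> restrict_space (LS_on g a b) {a..<t} = LS_on g a t"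
  by (subst restrict_restrict_space) (auto intro!: arg_cong2[where f = restrict_space])

lemma sets_LS_on_iff: "A \<in> sets (LS_on g a b) \<longleftrightarrow> A \<in> sets borel \<and> A \<subseteq> {a..<b}"
  by (subst sets_restrict_space_iff) auto

lemma emeasure_LS_on_interval:
  assumes "derivator g" "a \<le> s" "s \<le> t" "t \<le> b"
  shows "emeasure (LS_on g a b) {s..<t} = ennreal (g t - g s)"
  using assms by (subst emeasure_restrict_space) (auto simp: emeasure_LS_measure)

lemma space_LS_on [simp]: "space (LS_on g a b) = {a..<b}"
  by (simp add: space_restrict_space)

text \<open>As \<open>g\<close> is left-continuous, the mass of \<open>[s, t)\<close> is \<open>g t - g s\<close> also when \<open>t\<close> is an atom: the jump
  at \<open>t\<close> shows in the values of \<open>g\<close> only to the right of \<open>t\<close>.\<close>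

lemma norm_strong_integral_increment_le:
  fixes z :: "real \<Rightarrow> 'b::banach"
  assumes g: "derivator g" and st: "a \<le> s" "s \<le> t" "t \<le> b" and p: "1 \<le> p"
    and z: "z \<in> Lp_fun (LS_on g a b) p" "Lp_seminorm (LS_on g a b) p z \<le> K" and l: "0 < l"
  shows "norm (strong_integral (LS_on g a t) z - strong_integral (LS_on g a s) z)
    \<le> l powr (1 - p) * K powr p + l * (g t - g s)"
proof -
  let ?N = "LS_on g a b"
  have mono: "g s \<le> g t"
    using g st by (auto simp: derivator_def mono_def)
  have "(\<integral>\<^sup>+ r. ennreal (norm (z r)) \<partial>?N) = (\<integral>\<^sup>+ r. ennreal (norm (z r)) * indicator {a..<b} r \<partial>?N)"
    by (intro nn_integral_cong) simp
  also have "\<dots> \<le> ennreal (1 powr (1 - p) * K powr p) + ennreal 1 * emeasure ?N {a..<b}"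
    by (rule Lp_uniformly_integrable[OF p z]) (auto simp: sets_LS_on_iff)
  also have "\<dots> < \<infinity>"
    using st by (simp add: emeasure_LS_on_interval[OF g])
  finally have fin: "(\<integral>\<^sup>+ r. ennreal (norm (z r)) \<partial>?N) < \<infinity>" .
  have "ennreal (norm (strong_integral (restrict_space ?N {a..<t}) z - strong_integral (restrict_space ?N {a..<s}) z))
      \<le> (\<integral>\<^sup>+ r. ennreal (norm (z r)) * indicator ({a..<t} - {a..<s}) r \<partial>?N)"
    using z(1) fin st by (intro norm_strong_integral_restrict_diff_le) (auto simp: Lp_fun_def sets_LS_on_iff)
  also have "\<dots> \<le> ennreal (l powr (1 - p) * K powr p) + ennreal l * emeasure ?N ({a..<t} - {a..<s})"
    using st by (intro Lp_uniformly_integrable[OF p z _ l]) (auto simp: sets_LS_on_iff)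
  also have "{a..<t} - {a..<s} = {s..<t}"
    using st by auto
  also have "ennreal (l powr (1 - p) * K powr p) + ennreal l * emeasure ?N {s..<t}
      = ennreal (l powr (1 - p) * K powr p + l * (g t - g s))"
    using st l mono by (simp add: emeasure_LS_on_interval[OF g] flip: ennreal_mult ennreal_plus)
  finally show ?thesis
    using st l mono by (simp add: restrict_LS_on del: ennreal_plus)
qed

text \<open>The interval is partitioned according to the integer part of \<open>(g t - g a) / \<delta>\<close>. On each class
  \<open>g\<close> varies by at most \<open>\<delta>\<close>, hence so little of the integral of \<open>z\<close> accumulates between two of its
  points that \<open>T \<circ> u\<close> is nearly constant. Partitioning by values of \<open>g\<close> instead of by points of the
  line makes atoms harmless: points up to a large jump and points after it fall into different classes.

  Each of the finitely many classes of positive measure contains a point where \<open>u\<close> is bounded by a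
  constant that is the same for all \<open>u\<close>. There \<open>T (u s)\<close> lies in a fixed relatively
  compact set, so one of finitely many vectors approximates it. The approximating functions take
  one of these vectors on each class.\<close>

lemma evolution_states_finite_net:
  fixes T :: "'x::banach \<Rightarrow> 'y::banach"
  assumes g: "derivator g" and ab: "a < b" and T: "compact_operator T"
    and p0: "1 < p0" and p1: "1 < p1" and \<eta>: "0 < \<eta>"
  shows "\<exists>\<Phi> :: (real \<Rightarrow> 'y) set. finite \<Phi> \<and>
    (\<forall>u z x. u \<in> Lp_fun (LS_on g a b) p0 \<longrightarrow> Lp_seminorm (LS_on g a b) p0 u \<le> K \<longrightarrow>
       z \<in> Lp_fun (LS_on g a b) p1 \<longrightarrow> Lp_seminorm (LS_on g a b) p1 z \<le> K \<longrightarrow>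
       (AE t in LS_on g a b. T (u t) = x + strong_integral (LS_on g a t) z) \<longrightarrow>
       (\<exists>\<phi>\<in>\<Phi>. AE t in LS_on g a b. norm (T (u t) - \<phi> t) \<le> \<eta>))"
proof -
  let ?N = "LS_on g a b"
  have mono: "g s \<le> g t" if "s \<le> t" for s t
    using g that by (auto simp: derivator_def mono_def)
  have "((\<lambda>l. l powr (1 - p1) * K powr p1) \<longlongrightarrow> 0 * K powr p1) at_top"
    using p1 by (intro tendsto_mult tendsto_const tendsto_neg_powr filterlim_ident) auto
  then have "\<forall>\<^sub>F l in at_top. l powr (1 - p1) * K powr p1 < \<eta> / 4"
    by (rule order_tendstoD) (use \<eta> in simp)
  then have "\<forall>\<^sub>F l in at_top. l powr (1 - p1) * K powr p1 < \<eta> / 4 \<and> 0 < l"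
    by (intro eventually_conj eventually_gt_at_top)
  \<comment> \<open>As \<open>p1 > 1\<close>, the threshold \<open>l\<close> can be so large that only \<open>l * (g t - g s)\<close> matters.\<close>
  then obtain l where l: "0 < l" "l powr (1 - p1) * K powr p1 < \<eta> / 4"
    using eventually_happens by force
  define \<delta> where "\<delta> = \<eta> / (4 * l)"
  have \<delta>: "0 < \<delta>" "l * \<delta> = \<eta> / 4"
    using l \<eta> by (auto simp: \<delta>_def)
  define cls where "cls t = nat \<lfloor>(g t - g a) / \<delta>\<rfloor>" for t
  define A where "A k = {t \<in> {a..<b}. cls t = k}" for k
  have A_mono: "g t - g s \<le> \<delta>" if "s \<in> A k" "t \<in> A k" for s t k
  proof -
    have nn: "0 \<le> (g s - g a) / \<delta>" "0 \<le> (g t - g a) / \<delta>"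
      using that mono[of a s] mono[of a t] \<delta> by (auto simp: A_def)
    have "nat \<lfloor>(g t - g a) / \<delta>\<rfloor> = nat \<lfloor>(g s - g a) / \<delta>\<rfloor>"
      using that by (simp add: A_def cls_def)
    then have "\<lfloor>(g t - g a) / \<delta>\<rfloor> = \<lfloor>(g s - g a) / \<delta>\<rfloor>"
      using nn by (simp add: eq_nat_nat_iff)
    then have "(g t - g a) / \<delta> - (g s - g a) / \<delta> \<le> 1"
      by linarith
    then show ?thesis
      using \<delta> by (simp add: field_simps)
  qed
  have meas_A: "A k \<in> sets ?N" for k
  proof -
    have [measurable]: "g \<in> borel_measurable borel"
      using g by (intro borel_measurable_mono) (simp add: derivator_def)
    have "cls \<in> measurable borel (count_space UNIV)"
      unfolding cls_def by measurable
    then have "cls -` {k} \<inter> space borel \<in> sets borel"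
      by (rule measurable_sets) simp
    moreover have "A k = (cls -` {k} \<inter> space borel) \<inter> {a..<b}"
      by (auto simp: A_def)
    ultimately show ?thesis
      unfolding sets_LS_on_iff by (metis Int_lower2 atLeastLessThan_borel sets.Int)
  qed
  have finN: "emeasure ?N B \<noteq> \<infinity>" for B
  proof -
    have "emeasure ?N B \<le> emeasure ?N (space ?N)"
      by (rule emeasure_space)
    also have "\<dots> = ennreal (g b - g a)"
      using ab by (simp add: emeasure_LS_on_interval[OF g])
    finally show ?thesis
      by (auto simp: top_unique)
  qed
  define L where "L = cls b"
  define Q where "Q = {k \<in> {..L}. 0 < measure ?N (A k)}"
  have cls_le: "cls t \<le> L" if "t \<in> {a..<b}" for t
    using that mono[of t b] \<delta> unfolding cls_def L_def
    by (intro nat_mono floor_mono divide_right_mono) auto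
  have "AE t in ?N. \<forall>k\<in>{..L} - Q. t \<notin> A k"
  proof (rule AE_finite_allI)
    fix k assume "k \<in> {..L} - Q"
    then have "measure ?N (A k) = 0"
      using measure_nonneg[of ?N "A k"] by (auto simp: Q_def simp del: measure_nonneg)
    then have "emeasure ?N (A k) = 0"
      using finN[of "A k"] by (simp add: measure_def enn2real_eq_0_iff)
    then show "AE t in ?N. t \<notin> A k"
      using meas_A[of k] by (intro AE_not_in) (auto simp: null_sets_def)
  qed simp
  moreover have "AE t in ?N. t \<in> {a..<b}"
    using AE_space[of ?N] by simp
  ultimately have cls_Q: "AE t in ?N. t \<in> {a..<b} \<and> cls t \<in> Q"
  proof eventually_elim
    fix t assume t: "\<forall>k\<in>{..L} - Q. t \<notin> A k" "t \<in> {a..<b}"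
    then have "t \<in> A (cls t)"
      by (simp add: A_def)
    then show "t \<in> {a..<b} \<and> cls t \<in> Q"
      using t cls_le[of t] by blast
  qed
  define rad where "rad k = ((K powr p0 + 1) / measure ?N (A k)) powr (1 / p0)" for k
  have finQ: "finite Q"
    by (simp add: Q_def)
  have rad_le: "rad k \<le> (\<Sum>k\<in>Q. rad k)" if "k \<in> Q" for k
    using finQ that by (intro member_le_sum) (auto simp: rad_def)
  obtain Y where Y: "finite Y" "\<And>v. norm v \<le> (\<Sum>k\<in>Q. rad k) \<Longrightarrow> \<exists>y\<in>Y. norm (T v - y) < \<eta> / 2"
    using compact_operator_finite_net[OF T, of "\<eta> / 2" "\<Sum>k\<in>Q. rad k"] \<eta> by auto
  let ?\<Phi> = "(\<lambda>c t. c (cls t)) ` (Q \<rightarrow>\<^sub>E Y)"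
  show ?thesis
  proof (intro exI[of _ ?\<Phi>] conjI allI impI)
    show "finite ?\<Phi>"
      using finQ Y(1) by (intro finite_imageI finite_PiE)
    fix u :: "real \<Rightarrow> 'x" and z :: "real \<Rightarrow> 'y" and x :: 'y
    assume u: "u \<in> Lp_fun ?N p0" "Lp_seminorm ?N p0 u \<le> K"
      and z: "z \<in> Lp_fun ?N p1" "Lp_seminorm ?N p1 z \<le> K"
      and eq: "AE t in ?N. T (u t) = x + strong_integral (LS_on g a t) z"
    have osc: "norm (T (u t) - T (u s)) \<le> \<eta> / 2"
      if st: "s \<in> A k" "t \<in> A k" "T (u s) = x + strong_integral (LS_on g a s) z"
        "T (u t) = x + strong_integral (LS_on g a t) z" for s t k
    proof -
      have *: "norm (strong_integral (LS_on g a t) z - strong_integral (LS_on g a s) z) \<le> \<eta> / 2"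
        if "s \<in> A k" "t \<in> A k" "s \<le> t" for s t
      proof -
        have "norm (strong_integral (LS_on g a t) z - strong_integral (LS_on g a s) z)
            \<le> l powr (1 - p1) * K powr p1 + l * (g t - g s)"
          using that p1 by (intro norm_strong_integral_increment_le[OF g _ _ _ _ z l(1)]) (auto simp: A_def)
        moreover have "l * (g t - g s) \<le> l * \<delta>"
          using A_mono[OF that(1,2)] l(1) by (intro mult_left_mono) auto
        ultimately show ?thesis
          using l(2) \<delta>(2) by linarith
      qed
      show ?thesis
      proof (cases "s \<le> t")
        case True
        then show ?thesis
          using *[of s t] st by simp
      next
        case False
        then show ?thesis
          using *[of t s] st by (simp add: norm_minus_commute)
      qed
    qed
    have "\<exists>y\<in>Y. \<exists>s\<in>A k. T (u s) = x + strong_integral (LS_on g a s) z \<and> norm (T (u s) - y) < \<eta> / 2"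
      if k: "k \<in> Q" for k
    proof -
      have "\<exists>s\<in>A k. T (u s) = x + strong_integral (LS_on g a s) z \<and> norm (u s) \<le> rad k"
        unfolding rad_def using k p0 by (intro Lp_exists_bounded_value[OF _ u meas_A _ eq]) (auto simp: Q_def)
      then obtain s where s: "s \<in> A k" "T (u s) = x + strong_integral (LS_on g a s) z" "norm (u s) \<le> rad k"
        by blast
      obtain y where "y \<in> Y" "norm (T (u s) - y) < \<eta> / 2"
        using Y(2)[of "u s"] s(3) rad_le[OF k] by force
      with s show ?thesis
        by blast
    qed
    then obtain c where c: "\<And>k. k \<in> Q \<Longrightarrow> c k \<in> Y" "\<And>k. k \<in> Q \<Longrightarrow>
        \<exists>s\<in>A k. T (u s) = x + strong_integral (LS_on g a s) z \<and> norm (T (u s) - c k) < \<eta> / 2"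
      by metis
    show "\<exists>\<phi>\<in>?\<Phi>. AE t in ?N. norm (T (u t) - \<phi> t) \<le> \<eta>"
    proof (intro bexI)
      show "(\<lambda>t. restrict c Q (cls t)) \<in> ?\<Phi>"
        using c(1) by (intro image_eqI[of _ _ "restrict c Q"]) auto
      show "AE t in ?N. norm (T (u t) - restrict c Q (cls t)) \<le> \<eta>"
        using cls_Q eq
      proof eventually_elim
        fix t assume t: "t \<in> {a..<b} \<and> cls t \<in> Q" "T (u t) = x + strong_integral (LS_on g a t) z"
        then obtain s where s: "s \<in> A (cls t)" "T (u s) = x + strong_integral (LS_on g a s) z"
          "norm (T (u s) - c (cls t)) < \<eta> / 2"
          using c(2)[of "cls t"] by blast
        have "norm (T (u t) - T (u s)) \<le> \<eta> / 2"
          by (rule osc[OF s(1) _ s(2) t(2)]) (use t in \<open>simp add: A_def\<close>)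
        then show "norm (T (u t) - restrict c Q (cls t)) \<le> \<eta>"
          using s(3) norm_triangle_ineq[of "T (u t) - T (u s)" "T (u s) - c (cls t)"] t by simp
      qed
    qed
  qed
qed


section \<open>Compactness of the state projection\<close>

lemma state_projection_in_Lp_space:
  assumes "bounded_linear i" "0 < p0" "w \<in> evolution_graph g a b p0 p1 i01"
  shows "i \<circ> Lp_rep (fst w) \<in> Lp_fun (LS_on g a b) p0"
    "state_projection g a b p0 i w \<in> Lp_space (LS_on g a b) p0"
    "i \<circ> Lp_rep (fst w) \<in> state_projection g a b p0 i w"
proof -
  have "fst w \<in> Lp_space (LS_on g a b) p0"
    using assms(3) by (auto simp: evolution_graph_def)
  then show "i \<circ> Lp_rep (fst w) \<in> Lp_fun (LS_on g a b) p0"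
    using Lp_fun_bounded_linear_image[OF assms(1) Lp_rep_fun assms(2)] by (simp add: o_def)
  then show "state_projection g a b p0 i w \<in> Lp_space (LS_on g a b) p0"
    "i \<circ> Lp_rep (fst w) \<in> state_projection g a b p0 i w"
    unfolding state_projection_def by (intro Lp_class_in_Lp_space Lp_class_mem; assumption)+
qed

lemma evolution_graph_representatives:
  assumes w: "w \<in> evolution_graph g a b p0 p1 i01" and le: "evolution_norm g a b p0 p1 w \<le> K"
  shows "Lp_rep (fst w) \<in> Lp_fun (LS_on g a b) p0" "Lp_seminorm (LS_on g a b) p0 (Lp_rep (fst w)) \<le> K"
    "Lp_rep (snd w) \<in> Lp_fun (LS_on g a b) p1" "Lp_seminorm (LS_on g a b) p1 (Lp_rep (snd w)) \<le> K"
    "\<exists>x. AE t in LS_on g a b. i01 (Lp_rep (fst w) t) = x + strong_integral (LS_on g a t) (Lp_rep (snd w))"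
proof -
  have sp: "fst w \<in> Lp_space (LS_on g a b) p0" "snd w \<in> Lp_space (LS_on g a b) p1"
    using w by (auto simp: evolution_graph_def)
  show "Lp_rep (fst w) \<in> Lp_fun (LS_on g a b) p0" "Lp_rep (snd w) \<in> Lp_fun (LS_on g a b) p1"
    using sp by (auto intro: Lp_rep_fun)
  have "Lp_seminorm (LS_on g a b) p0 (Lp_rep (fst w)) + Lp_seminorm (LS_on g a b) p1 (Lp_rep (snd w)) \<le> K"
    using le by (simp add: evolution_norm_def Lp_norm_def)
  then show "Lp_seminorm (LS_on g a b) p0 (Lp_rep (fst w)) \<le> K"
    "Lp_seminorm (LS_on g a b) p1 (Lp_rep (snd w)) \<le> K"
    using Lp_seminorm_nonneg[of "LS_on g a b" p0 "Lp_rep (fst w)"]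
      Lp_seminorm_nonneg[of "LS_on g a b" p1 "Lp_rep (snd w)"] by linarith+
  show "\<exists>x. AE t in LS_on g a b. i01 (Lp_rep (fst w) t) = x + strong_integral (LS_on g a t) (Lp_rep (snd w))"
    using w by (intro evolution_graph_any_representative[of "fst w" "snd w"] Lp_rep_mem[OF sp(1)] Lp_rep_mem[OF sp(2)]) simp
qed

text \<open>The centres of the net are found in the set itself: one element is selected for each value of
  the code.\<close>

lemma (in Metric_space) mtotally_bounded_finite_code:
  fixes f :: "'w \<Rightarrow> 'a"
  assumes sub: "f ` S \<subseteq> M"
    and code: "\<And>e. 0 < e \<Longrightarrow> \<exists>c :: 'w \<Rightarrow> 'c. finite (c ` S) \<and> (\<forall>w\<in>S. \<forall>w'\<in>S. c w = c w' \<longrightarrow> d (f w) (f w') < e)"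
  shows "mtotally_bounded (f ` S)"
  unfolding mtotally_bounded_def
proof (intro allI impI)
  fix e :: real assume "0 < e"
  obtain c :: "'w \<Rightarrow> 'c" where c: "finite (c ` S)"
    "\<forall>w\<in>S. \<forall>w'\<in>S. c w = c w' \<longrightarrow> d (f w) (f w') < e"
    using code[OF \<open>0 < e\<close>] by (elim exE conjE) (rule that)
  let ?K = "(\<lambda>y. f (inv_into S c y)) ` c ` S"
  show "\<exists>K. finite K \<and> K \<subseteq> f ` S \<and> f ` S \<subseteq> (\<Union>x\<in>K. mball x e)"
  proof (intro exI[of _ ?K] conjI subsetI)
    show "finite ?K"
      using c(1) by (rule finite_imageI)
    show "y \<in> f ` S" if "y \<in> ?K" for y
      using that by (auto intro: inv_into_into)
    fix y assume "y \<in> f ` S"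
    then obtain w where w: "w \<in> S" "y = f w"
      by blast
    let ?v = "inv_into S c (c w)"
    have v: "?v \<in> S" "c ?v = c w"
      using w by (auto intro: inv_into_into f_inv_into_f)
    then have "y \<in> mball (f ?v) e"
      using c(2) w sub by auto
    then show "y \<in> (\<Union>x\<in>?K. mball x e)"
      using w(1) by blast
  qed
qed

text \<open>Two elements whose states, mapped to the largest space, are near the same member of a finite
  net are uniformly close there almost everywhere. Their distance in the smallest space is merely
  bounded, but Ehrling's inequality combines both facts into closeness in the middle space.\<close>

lemma mtotally_bounded_state_projection:
  fixes i0B :: "'b0::banach \<Rightarrow> 'b::banach" and iB1 :: "'b \<Rightarrow> 'b1::banach"
  assumes g: "derivator g" and ab: "a < b"
    and i0B: "compact_operator i0B" and iB1: "bounded_linear iB1" "inj iB1"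
    and p: "1 < p0" "1 < p1"
    and S: "S \<subseteq> evolution_graph g a b p0 p1 (iB1 \<circ> i0B)"
    and bound: "\<And>w. w \<in> S \<Longrightarrow> evolution_norm g a b p0 p1 w \<le> K"
  shows "Metric_space.mtotally_bounded (Lp_space (LS_on g a b) p0) (Lp_dist (LS_on g a b) p0)
    (state_projection g a b p0 i0B ` S)"
proof -
  let ?N = "LS_on g a b"
  let ?\<pi> = "state_projection g a b p0 i0B :: (real \<Rightarrow> 'b0) set \<times> (real \<Rightarrow> 'b1) set \<Rightarrow> _"
  let ?u = "\<lambda>w :: (real \<Rightarrow> 'b0) set \<times> (real \<Rightarrow> 'b1) set. Lp_rep (fst w)"
  interpret Metric_space "Lp_space ?N p0 :: (real \<Rightarrow> 'b) set set" "Lp_dist ?N p0"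
    using p by (intro Metric_space_Lp) simp
  have lin: "bounded_linear i0B"
    using i0B by (simp add: compact_operator_def)
  interpret i0B: bounded_linear i0B by (rule lin)
  interpret iB1: bounded_linear iB1 by (rule iB1(1))
  have p': "1 \<le> p0" "0 < p0"
    using p by auto
  note proj = state_projection_in_Lp_space[OF lin p'(2) subsetD[OF S]]
  note rep = evolution_graph_representatives[OF subsetD[OF S] bound]
  define m where "m = g b - g a"
  have m: "emeasure ?N (space ?N) = ennreal m" "0 \<le> m"
    using ab g emeasure_LS_on_interval[OF g, of a a b b] by (auto simp: m_def derivator_def mono_def)
  show ?thesis
  proof (rule mtotally_bounded_finite_code[where 'c = "real \<Rightarrow> 'b1"])
    show "?\<pi> ` S \<subseteq> Lp_space ?N p0"
      using proj(2) by blast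
    fix \<epsilon> :: real assume \<epsilon>: "0 < \<epsilon>"
    define K' where "K' = 2 * \<bar>K\<bar>"
    \<comment> \<open>The summand \<open>1\<close> in the denominators of \<open>e\<close> and \<open>\<eta>\<close> avoids division by zero.\<close>
    define e where "e = \<epsilon> / (8 * (K' + 1))"
    have K': "0 \<le> K'"
      by (simp add: K'_def)
    have e: "0 < e" "2 * e * K' \<le> \<epsilon> / 4"
      using K' \<epsilon> by (auto simp: e_def field_simps)
    obtain C where C: "0 \<le> C" "\<And>v. norm (i0B v) \<le> e * norm v + C * norm (iB1 (i0B v))"
      using Ehrling[OF i0B iB1 e(1)] by blast
    define \<eta> where "\<eta> = \<epsilon> / (16 * (C + 1) * (m + 1))"
    have \<eta>: "0 < \<eta>" "2 * (C * (2 * \<eta>)) * (m + 1) \<le> \<epsilon> / 4"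
    proof -
      show "0 < \<eta>"
        using \<epsilon> C m by (simp add: \<eta>_def)
      have "2 * (C * (2 * \<eta>)) * (m + 1) = \<epsilon> / 4 * (C / (C + 1))"
        using C m by (simp add: \<eta>_def divide_simps)
      also have "\<dots> \<le> \<epsilon> / 4 * 1"
        using \<epsilon> C by (intro mult_left_mono) auto
      finally show "2 * (C * (2 * \<eta>)) * (m + 1) \<le> \<epsilon> / 4"
        by simp
    qed
    obtain \<Phi> :: "(real \<Rightarrow> 'b1) set" where \<Phi>: "finite \<Phi>"
      and net: "\<forall>u z x. u \<in> Lp_fun ?N p0 \<longrightarrow> Lp_seminorm ?N p0 u \<le> K \<longrightarrow>
       z \<in> Lp_fun ?N p1 \<longrightarrow> Lp_seminorm ?N p1 z \<le> K \<longrightarrow>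
       (AE t in ?N. (iB1 \<circ> i0B) (u t) = x + strong_integral (LS_on g a t) z) \<longrightarrow>
       (\<exists>\<phi>\<in>\<Phi>. AE t in ?N. norm ((iB1 \<circ> i0B) (u t) - \<phi> t) \<le> \<eta>)"
      using evolution_states_finite_net[OF g ab compact_operator_compose[OF i0B iB1(1)] p \<eta>(1), of K]
      by (elim exE conjE) (rule that)
    have "\<exists>\<phi>\<in>\<Phi>. AE t in ?N. norm ((iB1 \<circ> i0B) (?u w t) - \<phi> t) \<le> \<eta>" if w: "w \<in> S" for w
    proof -
      obtain x where x: "AE t in ?N. (iB1 \<circ> i0B) (?u w t) = x + strong_integral (LS_on g a t) (Lp_rep (snd w))"
        using rep(5)[OF w w] by blast
      show ?thesis
        by (rule net[rule_format, OF rep(1)[OF w w] rep(2)[OF w w] rep(3)[OF w w] rep(4)[OF w w] x])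
    qed
    then obtain c where c: "\<And>w. w \<in> S \<Longrightarrow> c w \<in> \<Phi>"
      "\<And>w. w \<in> S \<Longrightarrow> AE t in ?N. norm ((iB1 \<circ> i0B) (?u w t) - c w t) \<le> \<eta>"
      by metis
    show "\<exists>c :: _ \<Rightarrow> real \<Rightarrow> 'b1. finite (c ` S) \<and> (\<forall>w\<in>S. \<forall>w'\<in>S. c w = c w' \<longrightarrow> Lp_dist ?N p0 (?\<pi> w) (?\<pi> w') < \<epsilon>)"
    proof (intro exI[where x = c] conjI ballI impI)
      show "finite (c ` S)"
        using c(1) by (intro finite_subset[OF _ \<Phi>]) blast
      fix w w' assume w: "w \<in> S" and w': "w' \<in> S" and same: "c w = c w'"
      let ?f = "\<lambda>t. ?u w t - ?u w' t"
      have f: "?f \<in> Lp_fun ?N p0"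
        by (rule Lp_fun_diff[OF p'(1) rep(1)[OF w w] rep(1)[OF w' w']])
      have fK: "Lp_seminorm ?N p0 ?f \<le> K'"
        using Lp_Minkowski[OF p'(1) rep(1)[OF w w] rep(1)[OF w' w']] rep(2)[OF w w] rep(2)[OF w' w']
        unfolding K'_def by linarith
      have "Lp_dist ?N p0 (?\<pi> w) (?\<pi> w') = Lp_seminorm ?N p0 (\<lambda>t. (i0B \<circ> ?u w) t - (i0B \<circ> ?u w') t)"
        by (rule Lp_dist_eq[OF proj(2)[OF w] proj(2)[OF w'] proj(3)[OF w] proj(3)[OF w']])
      also have "\<dots> \<le> \<epsilon> / 2"
      proof (rule Lp_seminorm_le_of_norm_le_affine[OF p'(1) m f fK])
        show "AE t in ?N. norm ((i0B \<circ> ?u w) t - (i0B \<circ> ?u w') t) \<le> e * norm (?f t) + C * (2 * \<eta>)"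
          using c(2)[OF w] c(2)[OF w']
        proof eventually_elim
          fix t assume "norm ((iB1 \<circ> i0B) (?u w t) - c w t) \<le> \<eta>" "norm ((iB1 \<circ> i0B) (?u w' t) - c w' t) \<le> \<eta>"
          then have "norm (iB1 (i0B (?f t))) \<le> 2 * \<eta>"
            using norm_triangle_ineq4[of "iB1 (i0B (?u w t)) - c w t" "iB1 (i0B (?u w' t)) - c w' t"] same
            by (simp add: i0B.diff iB1.diff)
          then have "C * norm (iB1 (i0B (?f t))) \<le> C * (2 * \<eta>)"
            by (rule mult_left_mono[OF _ C(1)])
          then show "norm ((i0B \<circ> ?u w) t - (i0B \<circ> ?u w') t) \<le> e * norm (?f t) + C * (2 * \<eta>)"
            using C(2)[of "?f t"] by (simp add: i0B.diff)
        qed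
      qed (use e \<eta> C in auto)
      finally show "Lp_dist ?N p0 (?\<pi> w) (?\<pi> w') < \<epsilon>"
        using \<epsilon> by linarith
    qed
  qed
qed

theorem theorem4p7:
  fixes g :: "real \<Rightarrow> real" and a b p0 p1 :: real
    and i0B :: "'b0::banach \<Rightarrow> 'b::banach" and iB1 :: "'b \<Rightarrow> 'b1::banach"
  assumes "derivator g" and "a < b"
    and "reflexive_space TYPE('b0)" and "reflexive_space TYPE('b1)"
    and "compact_operator i0B" and "inj i0B"
    and "bounded_linear iB1" and "inj iB1"
    and "1 < p0" and "1 < p1"
  shows "compact_map_on (evolution_graph g a b p0 p1 (iB1 \<circ> i0B)) (evolution_norm g a b p0 p1)
           (Lp_topology (LS_on g a b) p0) (state_projection g a b p0 i0B)
         \<and>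
         (\<forall>w :: nat \<Rightarrow> (real \<Rightarrow> 'b0) set \<times> (real \<Rightarrow> 'b1) set.
           (\<forall>n. w n \<in> evolution_graph g a b p0 p1 (iB1 \<circ> i0B)) \<and>
           (\<exists>C. \<forall>n. evolution_norm g a b p0 p1 (w n) \<le> C) \<longrightarrow>
           (\<exists>(r :: nat \<Rightarrow> nat) V. strict_mono r \<and> V \<in> Lp_space (LS_on g a b) p0 \<and>
              (\<lambda>n. Lp_dist (LS_on g a b) p0 (state_projection g a b p0 i0B (w (r n))) V) \<longlonglongrightarrow> 0))"
proof -
  let ?N = "LS_on g a b" and ?\<pi> = "state_projection g a b p0 i0B :: (real \<Rightarrow> 'b0) set \<times> (real \<Rightarrow> 'b1) set \<Rightarrow> _"
  let ?W = "evolution_graph g a b p0 p1 (iB1 \<circ> i0B)"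
  have p: "1 \<le> p0" "0 < p0"
    using assms by auto
  interpret Metric_space "Lp_space ?N p0 :: (real \<Rightarrow> 'b) set set" "Lp_dist ?N p0"
    by (rule Metric_space_Lp[OF p(1)])
  have lin: "bounded_linear i0B"
    using assms by (simp add: compact_operator_def)
  note proj = state_projection_in_Lp_space(2)[OF lin p(2)]
  have compact: "compactin mtopology (mtopology closure_of (?\<pi> ` S))"
    if "S \<subseteq> ?W" "\<And>w. w \<in> S \<Longrightarrow> evolution_norm g a b p0 p1 w \<le> C" for S C
    using mtotally_bounded_eq_compact_closure_of[OF mcomplete_Lp[OF p(1)]]
      mtotally_bounded_state_projection[OF assms(1,2,5,7,8,9,10) that] by blast
  have "compact_map_on ?W (evolution_norm g a b p0 p1) (Lp_topology ?N p0) ?\<pi>"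
    unfolding compact_map_on_def Lp_topology_def
  proof (intro conjI allI impI)
    show "?\<pi> ` ?W \<subseteq> topspace mtopology"
      using proj by auto
    fix S assume "S \<subseteq> ?W" "\<exists>C. \<forall>w\<in>S. evolution_norm g a b p0 p1 w \<le> C"
    then show "compactin mtopology (mtopology closure_of (?\<pi> ` S))"
      using compact by blast
  qed
  moreover have "\<exists>(r :: nat \<Rightarrow> nat) V. strict_mono r \<and> V \<in> Lp_space ?N p0 \<and>
      (\<lambda>n. Lp_dist ?N p0 (?\<pi> (w (r n))) V) \<longlonglongrightarrow> 0"
    if w: "\<And>n. w n \<in> ?W" and C: "\<And>n. evolution_norm g a b p0 p1 (w n) \<le> C" for w C
  proof -
    let ?S = "mtopology closure_of (?\<pi> ` range w)"
    have "compactin mtopology ?S"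
      by (rule compact[of _ C]) (use w C in auto)
    moreover have "range (\<lambda>n. ?\<pi> (w n)) \<subseteq> ?S"
    proof -
      have "?\<pi> ` range w \<subseteq> ?S"
        using proj[OF w] by (intro closure_of_subset image_subsetI) (auto elim!: rangeE)
      then show ?thesis
        by auto
    qed
    ultimately obtain V r where "strict_mono (r :: nat \<Rightarrow> nat)"
      and "limitin mtopology ((\<lambda>n. ?\<pi> (w n)) \<circ> r) V sequentially"
      unfolding compactin_sequentially by blast
    then show ?thesis
      by (intro exI[of _ r] exI[of _ V]) (simp add: limitin_metric_dist_null)
  qed
  ultimately show ?thesis
    by blast
qed

end
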